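(* Let $G$ be a double coset separable group and let $N$ be a finitely generated nilpotent group. Then the direct product $G \times N$ is double coset separable.
   Context: The profinite topology on a group $G$ has as a basis of open sets the cosets of finite index subgroups of $G$. A subset of $G$ is separable if it is closed in the profinite topology on $G$. A group $G$ is double coset separable if for all finitely generated subgroups $H, K \leqslant G$ the double coset $HK$ is separable in $G$ (equivalently, all double cosets $HgK$ with $g\in G$ are separable). *)

theory Defs
  imports "HOL-Analysis.Abstract_Topology" "HOL-Algebra.Generated_Groups"
begin

definition finite_index_subgroup :: "('a, 'b) monoid_scheme \<Rightarrow> 'a set \<Rightarrow> bool" where
  "finite_index_subgroup G H \<longleftrightarrow> subgroup H G \<and> finite (rcosets\<^bsub>G\<^esub> H)"

(* Right cosets suffice: the left coset aH is the right coset (aHa^-1)a, and conjugates of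
   finite index subgroups have finite index. *)
definition profinite_basis :: "('a, 'b) monoid_scheme \<Rightarrow> 'a set set" where
  "profinite_basis G = (\<Union>H \<in> {H. finite_index_subgroup G H}. rcosets\<^bsub>G\<^esub> H)"

definition profinite_topology :: "('a, 'b) monoid_scheme \<Rightarrow> 'a topology" where
  "profinite_topology G = topology (arbitrary union_of (\<lambda>U. U \<in> profinite_basis G))"

definition separable_in :: "('a, 'b) monoid_scheme \<Rightarrow> 'a set \<Rightarrow> bool" where
  "separable_in G X \<longleftrightarrow> closedin (profinite_topology G) X"

definition finitely_generated_subgroup :: "('a, 'b) monoid_scheme \<Rightarrow> 'a set \<Rightarrow> bool" where
  "finitely_generated_subgroup G H \<longleftrightarrow>
     subgroup H G \<and> (\<exists>S. finite S \<and> S \<subseteq> H \<and> H = generate G S)"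

definition finitely_generated_group :: "('a, 'b) monoid_scheme \<Rightarrow> bool" where
  "finitely_generated_group G \<longleftrightarrow> group G \<and> finitely_generated_subgroup G (carrier G)"

definition double_coset_separable :: "('a, 'b) monoid_scheme \<Rightarrow> bool" where
  "double_coset_separable G \<longleftrightarrow>
     group G \<and>
     (\<forall>H K. finitely_generated_subgroup G H \<longrightarrow> finitely_generated_subgroup G K
        \<longrightarrow> separable_in G (H <#>\<^bsub>G\<^esub> K))"

primrec lower_central :: "('a, 'b) monoid_scheme \<Rightarrow> nat \<Rightarrow> 'a set" where
  "lower_central G 0 = carrier G"
| "lower_central G (Suc n) =
     generate G {x \<otimes>\<^bsub>G\<^esub> y \<otimes>\<^bsub>G\<^esub> inv\<^bsub>G\<^esub> x \<otimes>\<^bsub>G\<^esub> inv\<^bsub>G\<^esub> y | x y.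
                   x \<in> lower_central G n \<and> y \<in> carrier G}"

definition nilpotent_group :: "('a, 'b) monoid_scheme \<Rightarrow> bool" where
  "nilpotent_group G \<longleftrightarrow> group G \<and> (\<exists>n. lower_central G n = {\<one>\<^bsub>G\<^esub>})"

lemma (in group) rcoset_Int:
  assumes "subgroup H G" "subgroup K G" "a \<in> carrier G" "b \<in> carrier G"
    and x: "x \<in> H #> a" "x \<in> K #> b"
  shows "(H #> a) \<inter> (K #> b) = (H \<inter> K) #> x"
proof -
  have xG: "x \<in> carrier G"
    using assms r_coset_subset_G subgroup.subset by blast
  have "H #> a = H #> x" "K #> b = K #> x"
    using assms repr_independence by auto
  moreover have "(H #> x) \<inter> (K #> x) = (H \<inter> K) #> x"
    using subgroup.mem_carrier[OF assms(1)] subgroup.mem_carrier[OF assms(2)] xG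
    unfolding r_coset_def by auto
  ultimately show ?thesis by simp
qed

lemma (in group) finite_index_subgroup_Int:
  assumes "finite_index_subgroup G H" "finite_index_subgroup G K"
  shows "finite_index_subgroup G (H \<inter> K)"
proof -
  have sub: "subgroup H G" "subgroup K G"
    and fin: "finite (rcosets H)" "finite (rcosets K)"
    using assms by (auto simp: finite_index_subgroup_def)
  have "rcosets (H \<inter> K) \<subseteq> (\<lambda>(C, D). C \<inter> D) ` ((rcosets H) \<times> (rcosets K))"
  proof
    fix E assume "E \<in> rcosets (H \<inter> K)"
    then obtain x where x: "x \<in> carrier G" "E = (H \<inter> K) #> x"
      by (auto simp: RCOSETS_def)
    then have "E = (H #> x) \<inter> (K #> x)"
      using rcoset_Int[OF sub x(1) x(1)] sub rcos_self by blast
    then show "E \<in> (\<lambda>(C, D). C \<inter> D) ` ((rcosets H) \<times> (rcosets K))"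
      using x(1) by (auto simp: RCOSETS_def)
  qed
  then have "finite (rcosets (H \<inter> K))"
    by (rule finite_subset) (use fin in auto)
  then show ?thesis
    using sub subgroups_Inter_pair by (auto simp: finite_index_subgroup_def)
qed

lemma (in group) istopology_profinite:
  "istopology (arbitrary union_of (\<lambda>U. U \<in> profinite_basis G))"
  unfolding istopology_base_eq
proof (intro allI impI, elim conjE)
  fix S T assume "S \<in> profinite_basis G" "T \<in> profinite_basis G"
  then obtain H K a b where *: "finite_index_subgroup G H" "finite_index_subgroup G K"
      "a \<in> carrier G" "b \<in> carrier G" "S = H #> a" "T = K #> b"
    by (auto simp: profinite_basis_def RCOSETS_def)
  then have sub: "subgroup H G" "subgroup K G"
    by (auto simp: finite_index_subgroup_def)
  show "(arbitrary union_of (\<lambda>U. U \<in> profinite_basis G)) (S \<inter> T)"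
  proof (cases "S \<inter> T = {}")
    case False
    then obtain x where x: "x \<in> H #> a" "x \<in> K #> b"
      using * by auto
    then have "x \<in> carrier G"
      using * sub r_coset_subset_G subgroup.subset by blast
    moreover have "S \<inter> T = (H \<inter> K) #> x"
      using rcoset_Int[OF sub] * x by blast
    ultimately have "S \<inter> T \<in> profinite_basis G"
      using finite_index_subgroup_Int *
      by (auto simp: profinite_basis_def RCOSETS_def)
    then show ?thesis
      by (simp add: arbitrary_union_of_inc)
  qed simp
qed

lemma (in group) openin_profinite_topology:
  "openin (profinite_topology G) U \<longleftrightarrow> (arbitrary union_of (\<lambda>U. U \<in> profinite_basis G)) U"
  by (simp add: profinite_topology_def istopology_profinite)

lemma (in group) topspace_profinite_topology: "topspace (profinite_topology G) = carrier G"
proof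
  have "U \<subseteq> carrier G" if "U \<in> profinite_basis G" for U
    using that rcosets_part_G by (auto simp: profinite_basis_def finite_index_subgroup_def)
  then have "U \<subseteq> carrier G" if "openin (profinite_topology G) U" for U
    using that unfolding openin_profinite_topology arbitrary_union_of_alt by blast
  then show "topspace (profinite_topology G) \<subseteq> carrier G"
    by (meson openin_topspace)
  have "rcosets (carrier G) \<subseteq> {carrier G}"
    by (auto simp: RCOSETS_def coset_join2 subgroup_self)
  then have "finite_index_subgroup G (carrier G)"
    using subgroup_self finite_subset by (auto simp: finite_index_subgroup_def)
  moreover have "carrier G \<in> rcosets (carrier G)"
    using coset_join2[OF one_closed subgroup_self] by (force simp: RCOSETS_def)
  ultimately have "carrier G \<in> profinite_basis G"
    by (auto simp: profinite_basis_def)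
  then have "openin (profinite_topology G) (carrier G)"
    by (simp add: openin_profinite_topology arbitrary_union_of_inc)
  then show "carrier G \<subseteq> topspace (profinite_topology G)"
    by (rule openin_subset)
qed

end

theory Submission
  imports Defs
begin

text \<open>
  Write \<open>P = G \<times> N\<close> and argue by Noetherian induction over the normal subgroups \<open>Z\<close> of \<open>N\<close>,
  from large to small, that \<open>HK\<close> is separable whenever \<open>H\<close> and \<open>K\<close> are finitely generated and
  \<open>1 \<times> Z \<subseteq> H\<close>. If \<open>Z\<close> has finite index, put \<open>L = G \<times> Z\<close>. Then \<open>HK\<close> is a finite union of
  translates of \<open>(H \<inter> L)(K \<inter> L)\<close>, which is the intersection of \<open>L\<close> with the preimage of a product of
  two finitely generated subgroups of \<open>G\<close>. If \<open>Z\<close> has infinite index, some \<open>z\<close> is central of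
  infinite order modulo \<open>Z\<close>. As \<open>{k. z\<^sup>k \<in> HK}\<close> is a subgroup of the integers, every \<open>x \<notin> HK\<close>
  lies outside \<open>H\<langle>z\<^sup>j\<rangle>K\<close> for some \<open>j > 0\<close>, and the latter set is separable by induction.
\<close>

section \<open>The profinite topology\<close>

context group
begin

text \<open>In right-nested words a letter and its inverse are followed by a tail \<open>x\<close>,
  where the plain inverse laws do not apply. With these rules \<open>word_simps\<close> reduces
  group words freely, which settles most word identities below.\<close>

lemma inv_mult_cancel_left:
  "\<lbrakk>a \<in> carrier G; x \<in> carrier G\<rbrakk> \<Longrightarrow> inv a \<otimes> (a \<otimes> x) = x"
  "\<lbrakk>a \<in> carrier G; x \<in> carrier G\<rbrakk> \<Longrightarrow> a \<otimes> (inv a \<otimes> x) = x"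
  by (simp_all add: m_assoc[symmetric])

lemmas word_simps = m_assoc inv_mult_group inv_mult_cancel_left

end

text \<open>By \<open>eq\<close>, elements of different cosets of \<open>M\<close> carry different
  labels \<open>f x\<close>, so the finite set of labels bounds the number of cosets.\<close>

lemma (in group) finite_index_subgroupI:
  assumes M: "subgroup M G" and f: "finite (f ` carrier G)"
    and eq: "\<And>x y. \<lbrakk>x \<in> carrier G; y \<in> carrier G; f x = f y\<rbrakk> \<Longrightarrow> x \<otimes> inv y \<in> M"
  shows "finite_index_subgroup G M"
proof -
  obtain T where T: "finite T" "T \<subseteq> carrier G" "f ` carrier G = f ` T"
    using finite_subset_image[OF f subset_refl] by metis
  have "rcosets M \<subseteq> (\<lambda>t. M #> t) ` T"
  proof
    fix C assume "C \<in> rcosets M"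
    then obtain x where x: "x \<in> carrier G" "C = M #> x" by (auto simp: RCOSETS_def)
    then obtain t where t: "t \<in> T" "f x = f t" using T(3) by (metis imageE imageI)
    then have "x \<otimes> inv t \<in> M" using eq x T by blast
    then have "x \<in> M #> t"
      using t T x subgroup.rcos_module_rev[OF M is_group] by blast
    then have "M #> t = M #> x" using repr_independence[OF _ _ M] t T by blast
    then show "C \<in> (\<lambda>t. M #> t) ` T" using t x by auto
  qed
  then show ?thesis using M T(1) finite_surj by (auto simp: finite_index_subgroup_def)
qed

text \<open>A basic open set that contains \<open>g\<close> is a coset of some \<open>M\<close>,
  hence equals \<open>M #> g\<close>. Proofs of separability then only have to name a suitable
  \<open>M\<close> for each \<open>g\<close>.\<close>

lemma (in group) separable_in_iff:
  "separable_in G X \<longleftrightarrow> X \<subseteq> carrier G \<and>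
     (\<forall>g \<in> carrier G - X. \<exists>M. finite_index_subgroup G M \<and> (M #> g) \<inter> X = {})"
proof -
  have *: "(\<exists>U \<in> profinite_basis G. g \<in> U \<and> U \<subseteq> carrier G - X) \<longleftrightarrow>
        (\<exists>M. finite_index_subgroup G M \<and> (M #> g) \<inter> X = {})" if g: "g \<in> carrier G - X" for g
  proof
    assume "\<exists>U \<in> profinite_basis G. g \<in> U \<and> U \<subseteq> carrier G - X"
    then obtain M a where M: "finite_index_subgroup G M" "a \<in> carrier G" "g \<in> M #> a" "M #> a \<subseteq> carrier G - X"
      by (auto simp: profinite_basis_def RCOSETS_def)
    then have "M #> g = M #> a"
      using repr_independence[of g M a] by (auto simp: finite_index_subgroup_def)
    then show "\<exists>M. finite_index_subgroup G M \<and> (M #> g) \<inter> X = {}" using M by blast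
  next
    assume "\<exists>M. finite_index_subgroup G M \<and> (M #> g) \<inter> X = {}"
    then obtain M where M: "finite_index_subgroup G M" "(M #> g) \<inter> X = {}" by blast
    then have "subgroup M G" by (simp add: finite_index_subgroup_def)
    then have "g \<in> M #> g" "M #> g \<subseteq> carrier G"
      using g rcos_self r_coset_subset_G[OF subgroup.subset] by auto
    then show "\<exists>U \<in> profinite_basis G. g \<in> U \<and> U \<subseteq> carrier G - X"
      using M g by (intro bexI[of _ "M #> g"]) (auto simp: profinite_basis_def RCOSETS_def)
  qed
  show ?thesis
    unfolding separable_in_def closedin_def topspace_profinite_topology openin_profinite_topology
      arbitrary_union_of_alt using * by (simp add: Bex_def cong: conj_cong)
qed

lemma (in group) separable_in_avoiding_coset:
  assumes "separable_in G X" "g \<in> carrier G" "g \<notin> X"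
  obtains M where "finite_index_subgroup G M" "(M #> g) \<inter> X = {}"
  using assms unfolding separable_in_iff by blast

lemma (in group) separable_in_Union:
  assumes "finite I" "\<And>i. i \<in> I \<Longrightarrow> separable_in G (X i)"
  shows "separable_in G (\<Union>i\<in>I. X i)"
  using assms unfolding separable_in_def by (auto intro: closedin_Union)

lemma (in group) separable_in_Int:
  assumes "separable_in G X" "separable_in G Y"
  shows "separable_in G (X \<inter> Y)"
  using assms unfolding separable_in_def by (rule closedin_Int)

text \<open>The complement of \<open>M\<close> is a union of cosets of \<open>M\<close>, so
  \<open>M\<close> itself is the witness at every point outside it.\<close>

lemma (in group) separable_in_finite_index:
  assumes "finite_index_subgroup G M"
  shows "separable_in G M"
  unfolding separable_in_iff
proof (intro conjI ballI)
  have M: "subgroup M G" using assms by (simp add: finite_index_subgroup_def)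
  then show "M \<subseteq> carrier G" by (rule subgroup.subset)
  fix g assume g: "g \<in> carrier G - M"
  have "x \<notin> M" if "x \<in> M #> g" for x
  proof
    assume "x \<in> M"
    with that obtain m where m: "m \<in> M" "m \<otimes> g \<in> M" by (auto simp: r_coset_def)
    then have "inv m \<otimes> (m \<otimes> g) \<in> M" using M by (simp add: subgroup.m_closed subgroup.m_inv_closed)
    then show False using g m M by (simp add: m_assoc[symmetric] subgroup.mem_carrier)
  qed
  then show "\<exists>M'. finite_index_subgroup G M' \<and> (M' #> g) \<inter> M = {}" using assms by blast
qed

section \<open>Preimages and translates of separable sets\<close>

lemma (in group_hom) subgroup_vimage:
  assumes "subgroup M H"
  shows "subgroup {x \<in> carrier G. h x \<in> M} G"
  using assms by (intro subgroup.intro)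
    (auto simp: subgroup.one_closed subgroup.m_closed subgroup.m_inv_closed)

text \<open>Labelling \<open>x\<close> by the coset of \<open>h x\<close> shows that the index
  cannot grow when passing to the preimage.\<close>

lemma (in group_hom) finite_index_subgroup_vimage:
  assumes "finite_index_subgroup H M"
  shows "finite_index_subgroup G {x \<in> carrier G. h x \<in> M}"
proof (rule G.finite_index_subgroupI[where f = "\<lambda>x. M #>\<^bsub>H\<^esub> h x"])
  have M: "subgroup M H" and fin: "finite (rcosets\<^bsub>H\<^esub> M)"
    using assms by (auto simp: finite_index_subgroup_def)
  show "subgroup {x \<in> carrier G. h x \<in> M} G" using M by (rule subgroup_vimage)
  show "finite ((\<lambda>x. M #>\<^bsub>H\<^esub> h x) ` carrier G)"
    by (rule finite_subset[OF _ fin]) (use hom_closed in \<open>unfold RCOSETS_def, blast\<close>)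
  fix x y assume *: "x \<in> carrier G" "y \<in> carrier G" "M #>\<^bsub>H\<^esub> h x = M #>\<^bsub>H\<^esub> h y"
  then have "h x \<in> M #>\<^bsub>H\<^esub> h y" using H.rcos_self[OF _ M] by (metis hom_closed)
  then have "h x \<otimes>\<^bsub>H\<^esub> inv\<^bsub>H\<^esub> h y \<in> M"
    using subgroup.rcos_module_imp[OF M] * by auto
  then show "x \<otimes> inv y \<in> {x \<in> carrier G. h x \<in> M}" using * by simp
qed

text \<open>Homomorphisms are continuous for the profinite topologies: the preimage of an
  \<open>M\<close> that works at \<open>h g\<close> works at \<open>g\<close>.\<close>

lemma (in group_hom) separable_in_vimage:
  assumes "separable_in H X"
  shows "separable_in G {x \<in> carrier G. h x \<in> X}"
  unfolding G.separable_in_iff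
proof (intro conjI ballI)
  fix g assume g: "g \<in> carrier G - {x \<in> carrier G. h x \<in> X}"
  then obtain M where M: "finite_index_subgroup H M" "(M #>\<^bsub>H\<^esub> h g) \<inter> X = {}"
    using H.separable_in_avoiding_coset[OF assms, of "h g"] by auto
  have "({x \<in> carrier G. h x \<in> M} #> g) \<inter> {x \<in> carrier G. h x \<in> X} = {}"
    using M(2) g by (auto simp: r_coset_def)
  then show "\<exists>M. finite_index_subgroup G M \<and> (M #> g) \<inter> {x \<in> carrier G. h x \<in> X} = {}"
    using finite_index_subgroup_vimage[OF M(1)] by blast
qed auto

text \<open>Right translation by \<open>a\<close> carries a coset of \<open>M\<close> around g a^-1
  that misses \<open>X\<close> to one around \<open>g\<close> that misses \<open>X #> a\<close>, so
  the same \<open>M\<close> works.\<close>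

lemma (in group) separable_in_r_coset:
  assumes X: "separable_in G X" and a: "a \<in> carrier G"
  shows "separable_in G (X #> a)"
  unfolding separable_in_iff
proof (intro conjI ballI)
  have XG: "X \<subseteq> carrier G" using X by (simp add: separable_in_iff)
  then show "X #> a \<subseteq> carrier G" using a by (rule r_coset_subset_G)
  fix g assume g: "g \<in> carrier G - (X #> a)"
  have "g \<otimes> inv a \<notin> X"
  proof
    assume "g \<otimes> inv a \<in> X"
    then have "g \<otimes> inv a \<otimes> a \<in> X #> a" by (auto simp: r_coset_def)
    then show False using g a by (simp add: m_assoc)
  qed
  then obtain M where M: "finite_index_subgroup G M" "(M #> (g \<otimes> inv a)) \<inter> X = {}"
    using separable_in_avoiding_coset[OF X, of "g \<otimes> inv a"] g a by auto
  have MG: "M \<subseteq> carrier G" using M by (auto simp: finite_index_subgroup_def subgroup.subset)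
  have "False" if y: "y \<in> M #> g" "y \<in> X #> a" for y
  proof -
    obtain m where m: "m \<in> M" "y = m \<otimes> g" using y(1) by (auto simp: r_coset_def)
    moreover obtain x where "x \<in> X" "y = x \<otimes> a" using y(2) by (auto simp: r_coset_def)
    ultimately have mx: "m \<in> M" "x \<in> X" "y = m \<otimes> g" "y = x \<otimes> a" by auto
    moreover have "m \<in> carrier G" "x \<in> carrier G" using mx MG XG by auto
    ultimately have "x = m \<otimes> g \<otimes> inv a" "m \<in> carrier G"
      using g a by (simp_all add: inv_solve_right)
    then have "x = m \<otimes> (g \<otimes> inv a)" using g a by (simp add: m_assoc)
    then show False using M(2) mx by (auto simp: r_coset_def)
  qed
  then show "\<exists>M. finite_index_subgroup G M \<and> (M #> g) \<inter> (X #> a) = {}" using M(1) by blast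
qed

lemma (in group) conj_group_hom:
  assumes a: "a \<in> carrier G"
  shows "group_hom G G (\<lambda>x. inv a \<otimes> x \<otimes> a)"
proof -
  have "inv a \<otimes> (x \<otimes> y) \<otimes> a = inv a \<otimes> x \<otimes> a \<otimes> (inv a \<otimes> y \<otimes> a)"
    if "x \<in> carrier G" "y \<in> carrier G" for x y
    using that a by (simp add: word_simps)
  then show ?thesis
    using a by (intro group_hom.intro group_hom_axioms.intro is_group) (auto simp: hom_def)
qed

text \<open>The basis consists of right cosets, so the left translate is rewritten as aX = (a X
  a^-1) a: a preimage of \<open>X\<close> under an inner automorphism, translated on the
  right.\<close>

lemma (in group) separable_in_l_coset:
  assumes X: "separable_in G X" and a: "a \<in> carrier G"
  shows "separable_in G (a <# X)"
proof -
  interpret c: group_hom G G "\<lambda>x. inv a \<otimes> x \<otimes> a" using a by (rule conj_group_hom)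
  have XG: "X \<subseteq> carrier G" using X by (simp add: separable_in_iff)
  have "a <# X = {x \<in> carrier G. inv a \<otimes> x \<otimes> a \<in> X} #> a" (is "?L = ?R")
  proof (intro subset_antisym subsetI)
    fix y assume "y \<in> ?L"
    then obtain x where x: "x \<in> X" "y = a \<otimes> x" by (auto simp: l_coset_def)
    then have "a \<otimes> x \<otimes> inv a \<in> {x \<in> carrier G. inv a \<otimes> x \<otimes> a \<in> X}"
      using XG a by (auto simp: word_simps subset_iff)
    moreover have "y = a \<otimes> x \<otimes> inv a \<otimes> a" using x XG a by (auto simp: m_assoc subset_iff)
    ultimately show "y \<in> ?R" unfolding r_coset_def by blast
  next
    fix y assume "y \<in> ?R"
    then obtain x where x: "x \<in> carrier G" "inv a \<otimes> x \<otimes> a \<in> X" "y = x \<otimes> a" by (auto simp: r_coset_def)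
    then have "y = a \<otimes> (inv a \<otimes> x \<otimes> a)" using a by (simp add: m_assoc[symmetric])
    then show "y \<in> ?L" using x by (auto simp: l_coset_def)
  qed
  then show ?thesis using separable_in_r_coset[OF c.separable_in_vimage[OF X] a] by simp
qed

section \<open>Finitely generated subgroups\<close>

lemma (in group) finitely_generated_subgroupE:
  assumes "finitely_generated_subgroup G H"
  obtains S where "subgroup H G" "finite S" "S \<subseteq> H" "S \<subseteq> carrier G" "H = generate G S"
proof -
  obtain S where "subgroup H G" "finite S" "S \<subseteq> H" "H = generate G S"
    using assms unfolding finitely_generated_subgroup_def by blast
  then show thesis using subgroup.subset[of H G] by (intro that[of S]) auto
qed

lemma (in group) finitely_generated_subgroupI:
  assumes "finite S" "S \<subseteq> carrier G" "H = generate G S"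
  shows "finitely_generated_subgroup G H"
  unfolding finitely_generated_subgroup_def
  using assms generate_is_subgroup[of S] generate.incl[of _ S G] by auto

lemma (in group_hom) finitely_generated_subgroup_img:
  assumes "finitely_generated_subgroup G K"
  shows "finitely_generated_subgroup H (h ` K)"
proof -
  obtain S where S: "finite S" "S \<subseteq> carrier G" "K = generate G S"
    using assms G.finitely_generated_subgroupE by metis
  then show ?thesis
    by (intro H.finitely_generated_subgroupI[of "h ` S"]) (auto simp: generate_img)
qed

lemma (in group) finitely_generated_subgroup_insert:
  assumes "finitely_generated_subgroup G H" "x \<in> carrier G"
  shows "finitely_generated_subgroup G (generate G (insert x H))"
proof -
  obtain S where S: "subgroup H G" "finite S" "S \<subseteq> H" "S \<subseteq> carrier G" "H = generate G S"
    using assms(1) finitely_generated_subgroupE by metis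
  have sub: "subgroup (generate G (insert x S)) G"
    using S assms(2) by (intro generate_is_subgroup) auto
  have "generate G (insert x H) \<subseteq> generate G (insert x S)"
    using sub S(5) mono_generate[of S "insert x S"]
    by (intro generate_subgroup_incl) (auto intro: generate.incl)
  moreover have "generate G (insert x S) \<subseteq> generate G (insert x H)"
    using S(3) by (intro mono_generate) auto
  ultimately show ?thesis
    using S assms(2) by (intro finitely_generated_subgroupI[of "insert x S"]) auto
qed

text \<open>Schreier's argument, with any finite set \<open>T\<close> that meets all cosets in place of a transversal.\<close>

lemma (in group) finitely_generated_subgroup_finite_index:
  assumes H: "finitely_generated_subgroup G H" and K: "subgroup K G" "K \<subseteq> H"
    and T: "finite T" "T \<subseteq> H" "\<And>h. h \<in> H \<Longrightarrow> \<exists>t\<in>T. h \<otimes> inv t \<in> K"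
  shows "finitely_generated_subgroup G K"
proof -
  obtain S where S: "subgroup H G" "finite S" "S \<subseteq> H" "S \<subseteq> carrier G" "H = generate G S"
    using H finitely_generated_subgroupE by metis
  interpret H: subgroup H G by (rule S)
  interpret K: subgroup K G by (rule K)
  define R where "R = S \<union> m_inv G ` S"
  \<comment> \<open>The Schreier generators t s u^-1, together with the elements of \<open>T\<close>
    that lie in \<open>K\<close>. \<open>T\<close> may represent a coset several times and need not
    contain the identity, hence the intersection with \<open>K\<close> and the added
    \<open>\<one>\<close>.\<close>
  define Y where "Y = K \<inter> (insert \<one> T \<union> (\<lambda>(t, s, u). t \<otimes> s \<otimes> inv u) ` (insert \<one> T \<times> R \<times> T))"
  define W where "W = generate G Y"
  have "m_inv G ` S \<subseteq> H" using S(3) H.m_inv_closed by blast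
  then have R: "R \<subseteq> H" "finite R" using S(2,3) by (simp_all add: R_def)
  have Y: "finite Y" "Y \<subseteq> K" using T R by (auto simp: Y_def)
  then have YG: "Y \<subseteq> carrier G" using K.subset by blast
  interpret W: subgroup W G unfolding W_def using YG by (rule generate_is_subgroup)
  have WK: "W \<subseteq> K" unfolding W_def using Y K by (intro generate_subgroup_incl)
  \<comment> \<open>The products of \<open>W\<close> with \<open>insert \<one> T\<close> are stable
    under right multiplication by a letter: \<open>u\<close> represents the coset of
    \<open>t \<otimes> s\<close>, and t s u^-1 is absorbed into \<open>W\<close>.\<close>
  have step: "\<exists>w'\<in>W. \<exists>t'\<in>insert \<one> T. w \<otimes> t \<otimes> s = w' \<otimes> t'"
    if "w \<in> W" "t \<in> insert \<one> T" "s \<in> R" for w t s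
  proof -
    have tH: "t \<in> H" "s \<in> H" using that T R by auto
    then obtain u where u: "u \<in> T" "t \<otimes> s \<otimes> inv u \<in> K" using T(3)[of "t \<otimes> s"] by auto
    have uH: "u \<in> H" using u T by auto
    have "t \<otimes> s \<otimes> inv u \<in> Y" unfolding Y_def using u that by force
    then have "w \<otimes> (t \<otimes> s \<otimes> inv u) \<in> W" using that by (auto simp: W_def intro: generate.incl generate.eng)
    moreover have "w \<otimes> t \<otimes> s = w \<otimes> (t \<otimes> s \<otimes> inv u) \<otimes> u"
      using tH uH that by (simp add: word_simps)
    ultimately show ?thesis using u by blast
  qed
  have steps: "\<forall>w\<in>W. \<forall>t\<in>insert \<one> T. \<exists>w'\<in>W. \<exists>t'\<in>insert \<one> T. w \<otimes> t \<otimes> h = w' \<otimes> t'"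
    if "h \<in> generate G S" for h
    using that
  proof (induction h rule: generate.induct)
    case one
    have "w \<otimes> t \<otimes> \<one> = w \<otimes> t" if "w \<in> W" "t \<in> insert \<one> T" for w t
      using that T by auto
    then show ?case by blast
  next
    case (incl h)
    then show ?case using step by (auto simp: R_def)
  next
    case (inv h)
    then show ?case using step by (auto simp: R_def)
  next
    case (eng h1 h2)
    show ?case
    proof (intro ballI)
      fix w t assume wt: "w \<in> W" "t \<in> insert \<one> T"
      obtain w' t' where 1: "w' \<in> W" "t' \<in> insert \<one> T" "w \<otimes> t \<otimes> h1 = w' \<otimes> t'"
        using eng(3) wt by blast
      obtain w'' t'' where 2: "w'' \<in> W" "t'' \<in> insert \<one> T" "w' \<otimes> t' \<otimes> h2 = w'' \<otimes> t''"
        using eng(4) 1 by blast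
      have "h1 \<in> carrier G" "h2 \<in> carrier G" "t \<in> carrier G"
        using eng(1,2) generate_in_carrier[OF S(4)] wt T by auto
      then have "w \<otimes> t \<otimes> (h1 \<otimes> h2) = w'' \<otimes> t''"
        using 1(3) 2(3) wt(1) by (simp add: m_assoc[symmetric])
      then show "\<exists>w'\<in>W. \<exists>t'\<in>insert \<one> T. w \<otimes> t \<otimes> (h1 \<otimes> h2) = w' \<otimes> t'"
        using 2 by blast
    qed
  qed
  have "K \<subseteq> W"
  proof
    fix k assume k: "k \<in> K"
    then have "k \<in> generate G S" using K(2) S(5) by auto
    from bspec[OF bspec[OF steps[OF this] W.one_closed] insertI1]
    obtain w t where "w \<in> W" "t \<in> insert \<one> T" "\<one> \<otimes> \<one> \<otimes> k = w \<otimes> t" by blast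
    with k have wt: "w \<in> W" "t \<in> insert \<one> T" "k = w \<otimes> t" by auto
    have tG: "t \<in> carrier G" using wt T by auto
    \<comment> \<open>The remainder \<open>t\<close> lies in \<open>K\<close>, so it is itself one
      of the generators in \<open>Y\<close>.\<close>
    have "t = inv w \<otimes> k" using wt tG k by (simp add: inv_mult_cancel_left)
    moreover have "inv w \<in> K" using wt(1) WK by auto
    ultimately have "t \<in> K" using k K.m_closed by metis
    then have "t \<in> W" using wt by (auto simp: W_def Y_def intro: generate.incl)
    then show "k \<in> W" using wt k by simp
  qed
  then show ?thesis
    using WK Y YG by (intro finitely_generated_subgroupI[of Y]) (auto simp: W_def)
qed

section \<open>Finitely generated nilpotent groups\<close>

text \<open>For normal \<open>Z\<close> this is the preimage of the centralizer of the image of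
  \<open>y\<close> in G/Z, and \<open>center_mod\<close> is the preimage of the center of G/Z.
  Commutators in \<open>G\<close> match the form of \<open>lower_central\<close> and avoid computing
  in the quotient. Below, [x, y] stands for x y x^-1 y^-1.\<close>

definition centralizer_mod :: "('a, 'b) monoid_scheme \<Rightarrow> 'a set \<Rightarrow> 'a \<Rightarrow> 'a set" where
  "centralizer_mod G Z y =
     {x \<in> carrier G. x \<otimes>\<^bsub>G\<^esub> y \<otimes>\<^bsub>G\<^esub> inv\<^bsub>G\<^esub> x \<otimes>\<^bsub>G\<^esub> inv\<^bsub>G\<^esub> y \<in> Z}"

definition center_mod :: "('a, 'b) monoid_scheme \<Rightarrow> 'a set \<Rightarrow> 'a set" where
  "center_mod G Z = {x \<in> carrier G. \<forall>y \<in> carrier G. x \<in> centralizer_mod G Z y}"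

text \<open>Closure follows from [a^-1, y] = a^-1 [a, y]^-1 a and [ab, y] = a [b, y] a^-1 [a, y];
  normality keeps the conjugates in \<open>H\<close>.\<close>

lemma (in normal) subgroup_centralizer_mod:
  assumes y: "y \<in> carrier G"
  shows "subgroup (centralizer_mod G H y) G"
proof (intro subgroup.intro)
  show "centralizer_mod G H y \<subseteq> carrier G" by (auto simp: centralizer_mod_def)
  show "\<one> \<in> centralizer_mod G H y" using y by (simp add: centralizer_mod_def)
  fix a assume "a \<in> centralizer_mod G H y"
  then have a: "a \<in> carrier G" "a \<otimes> y \<otimes> inv a \<otimes> inv y \<in> H" by (auto simp: centralizer_mod_def)
  have "inv a \<otimes> inv (a \<otimes> y \<otimes> inv a \<otimes> inv y) \<otimes> a \<in> H"
    using a y by (intro inv_op_closed1) auto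
  then have "inv a \<otimes> y \<otimes> inv (inv a) \<otimes> inv y \<in> H" using a y by (simp add: word_simps)
  then show "inv a \<in> centralizer_mod G H y" using a by (simp add: centralizer_mod_def)
  fix b assume "b \<in> centralizer_mod G H y"
  then have b: "b \<in> carrier G" "b \<otimes> y \<otimes> inv b \<otimes> inv y \<in> H" by (auto simp: centralizer_mod_def)
  have "a \<otimes> (b \<otimes> y \<otimes> inv b \<otimes> inv y) \<otimes> inv a \<otimes> (a \<otimes> y \<otimes> inv a \<otimes> inv y) \<in> H"
    using subgroup.m_closed[OF subgroup_axioms inv_op_closed2[OF a(1) b(2)] a(2)] .
  then have "a \<otimes> b \<otimes> y \<otimes> inv (a \<otimes> b) \<otimes> inv y \<in> H" using a b y by (simp add: word_simps)
  then show "a \<otimes> b \<in> centralizer_mod G H y" using a b by (simp add: centralizer_mod_def)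
qed

text \<open>[y, x] is the inverse of [x, y].\<close>

lemma (in normal) centralizer_mod_sym:
  assumes "x \<in> carrier G" "y \<in> carrier G"
  shows "x \<in> centralizer_mod G H y \<longleftrightarrow> y \<in> centralizer_mod G H x"
proof -
  have "b \<in> centralizer_mod G H a" if "a \<in> centralizer_mod G H b" "b \<in> carrier G" for a b
  proof -
    have a: "a \<in> carrier G" "inv (a \<otimes> b \<otimes> inv a \<otimes> inv b) \<in> H"
      using that by (auto simp: centralizer_mod_def)
    then show ?thesis using that by (simp add: centralizer_mod_def word_simps)
  qed
  then show ?thesis using assms by blast
qed

text \<open>[h, y] is the product of \<open>h\<close> and a conjugate of its inverse.\<close>

lemma (in normal) subset_center_mod: "H \<subseteq> center_mod G H"
proof -
  have "h \<otimes> y \<otimes> inv h \<otimes> inv y \<in> H" if "h \<in> H" "y \<in> carrier G" for h y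
  proof -
    have "h \<otimes> (y \<otimes> inv h \<otimes> inv y) \<in> H" using that by (intro subgroup.m_closed[OF subgroup_axioms] inv_op_closed2) auto
    then show ?thesis using that by (simp add: m_assoc)
  qed
  then show ?thesis by (auto simp: center_mod_def centralizer_mod_def)
qed

lemma (in normal) subgroup_center_mod: "subgroup (center_mod G H) G"
proof -
  have "center_mod G H = (\<Inter>y\<in>carrier G. centralizer_mod G H y)"
    by (auto simp: center_mod_def centralizer_mod_def)
  then show ?thesis
    using subgroup_centralizer_mod subgroups_Inter[of "centralizer_mod G H ` carrier G"] by auto
qed

text \<open>The centralizer of \<open>x\<close> modulo \<open>H\<close> is a subgroup and, by
  symmetry, contains the generating set \<open>Y\<close>.\<close>

lemma (in normal) center_modI_generate:
  assumes Y: "Y \<subseteq> carrier G" "generate G Y = carrier G"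
    and x: "x \<in> carrier G" "\<And>y. y \<in> Y \<Longrightarrow> x \<in> centralizer_mod G H y"
  shows "x \<in> center_mod G H"
proof -
  have "Y \<subseteq> centralizer_mod G H x" using assms centralizer_mod_sym by blast
  then have "carrier G \<subseteq> centralizer_mod G H x"
    using generate_subgroup_incl[OF _ subgroup_centralizer_mod[OF x(1)]] Y(2) by blast
  then show ?thesis using x centralizer_mod_sym by (auto simp: center_mod_def)
qed

text \<open>y a y^-1 = a [a^-1, y], where the commutator lies in \<open>H\<close> and so in
  \<open>A\<close>.\<close>

lemma (in normal) normal_between_center_mod:
  assumes "subgroup A G" "H \<subseteq> A" "A \<subseteq> center_mod G H"
  shows "A \<lhd> G"
proof (rule normal_invI[OF assms(1)])
  interpret A: subgroup A G by (rule assms(1))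
  fix y a assume ya: "y \<in> carrier G" "a \<in> A"
  then have "inv a \<in> center_mod G H" using assms(3) by auto
  then have "inv a \<in> centralizer_mod G H y" using ya by (simp add: center_mod_def)
  then have "inv a \<otimes> y \<otimes> a \<otimes> inv y \<in> H" using ya by (simp add: centralizer_mod_def)
  then have "a \<otimes> (inv a \<otimes> y \<otimes> a \<otimes> inv y) \<in> A" using ya assms(2) by auto
  then show "y \<otimes> a \<otimes> inv y \<in> A" using ya by (simp add: word_simps)
qed

lemma (in normal) center_mod_mono:
  assumes "H \<subseteq> A"
  shows "center_mod G H \<subseteq> center_mod G A"
  using assms by (auto simp: center_mod_def centralizer_mod_def)

lemma (in normal) center_mod_commute:
  assumes "x \<in> center_mod G H" "y \<in> carrier G"
  obtains m where "m \<in> H" "x \<otimes> y = m \<otimes> y \<otimes> x"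
proof
  show "x \<otimes> y \<otimes> inv x \<otimes> inv y \<in> H"
    using assms by (auto simp: center_mod_def centralizer_mod_def)
  show "x \<otimes> y = x \<otimes> y \<otimes> inv x \<otimes> inv y \<otimes> y \<otimes> x"
    using assms by (simp add: word_simps center_mod_def)
qed

section \<open>Extensions by a cyclic group\<close>

text \<open>Since \<open>x\<close> normalizes \<open>U\<close>, the product of \<open>U\<close> with
  the powers of \<open>x\<close> is closed under multiplication and inverses. Both parts of
  \<open>conj\<close> are assumed because conjugation by \<open>x\<close> might map \<open>U\<close>
  properly into itself.\<close>

lemma (in group) generate_insert_eq:
  assumes U: "subgroup U G" and x: "x \<in> carrier G"
    and conj: "\<And>u. u \<in> U \<Longrightarrow> x \<otimes> u \<otimes> inv x \<in> U" "\<And>u. u \<in> U \<Longrightarrow> inv x \<otimes> u \<otimes> x \<in> U"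
  shows "generate G (insert x U) = {u \<otimes> x [^] k | u (k::int). u \<in> U}"
proof (rule generateI[symmetric])
  interpret U: subgroup U G by (rule U)
  have pow: "x [^] k \<otimes> u \<otimes> inv (x [^] k) \<in> U" if "u \<in> U" for k :: int and u
    using that
  proof (induction k arbitrary: u rule: int_induct[where k = 0])
    case base
    then show ?case by simp
  next
    case (step1 i)
    then have "x [^] i \<otimes> (x \<otimes> u \<otimes> inv x) \<otimes> inv (x [^] i) \<in> U" using conj by blast
    then show ?case using x step1 by (simp add: int_pow_mult word_simps)
  next
    case (step2 i)
    then have "x [^] i \<otimes> (inv x \<otimes> u \<otimes> x) \<otimes> inv (x [^] i) \<in> U" using conj by blast
    then show ?case using x step2 by (simp add: int_pow_diff word_simps)
  qed
  show "subgroup {u \<otimes> x [^] k | u (k::int). u \<in> U} G"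
  proof (intro subgroup.intro)
    show "{u \<otimes> x [^] k | u (k::int). u \<in> U} \<subseteq> carrier G" using x by auto
    have "\<one> = \<one> \<otimes> x [^] (0::int)" by simp
    then show "\<one> \<in> {u \<otimes> x [^] k | u (k::int). u \<in> U}" using U.one_closed by blast
    fix a assume "a \<in> {u \<otimes> x [^] k | u (k::int). u \<in> U}"
    then obtain u k where a: "u \<in> U" "a = u \<otimes> x [^] (k::int)" by blast
    have "x [^] (-k) \<otimes> inv u \<otimes> inv (x [^] (-k)) \<in> U" using a pow by blast
    moreover have "inv a = x [^] (-k) \<otimes> inv u \<otimes> inv (x [^] (-k)) \<otimes> x [^] (-k)"
      using a x by (simp add: word_simps int_pow_neg)
    ultimately show "inv a \<in> {u \<otimes> x [^] k | u (k::int). u \<in> U}" by blast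
    fix b assume "b \<in> {u \<otimes> x [^] k | u (k::int). u \<in> U}"
    then obtain v l where b: "v \<in> U" "b = v \<otimes> x [^] (l::int)" by blast
    have "u \<otimes> (x [^] k \<otimes> v \<otimes> inv (x [^] k)) \<in> U" using a b pow by blast
    moreover have "a \<otimes> b = u \<otimes> (x [^] k \<otimes> v \<otimes> inv (x [^] k)) \<otimes> x [^] (k + l)"
      using a b x by (simp add: word_simps int_pow_mult)
    ultimately show "a \<otimes> b \<in> {u \<otimes> x [^] k | u (k::int). u \<in> U}" by blast
  qed
  have "x = \<one> \<otimes> x [^] (1::int)" using x by simp
  then have "x \<in> {u \<otimes> x [^] k | u (k::int). u \<in> U}" using U.one_closed by blast
  moreover have "u \<in> {u \<otimes> x [^] k | u (k::int). u \<in> U}" if "u \<in> U" for u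
  proof -
    have "u = u \<otimes> x [^] (0::int)" using that by simp
    then show ?thesis using that by blast
  qed
  ultimately show "insert x U \<subseteq> {u \<otimes> x [^] k | u (k::int). u \<in> U}" by blast
  fix K assume K: "subgroup K G" "insert x U \<subseteq> K"
  then show "{u \<otimes> x [^] k | u (k::int). u \<in> U} \<subseteq> K"
    using subgroup_int_pow_closed[OF K(1), of x] subgroup.m_closed[OF K(1)] by blast
qed

text \<open>Modulo \<open>H\<close> the group generated by \<open>x\<close> and \<open>H\<close> is
  cyclic, so the image of \<open>U\<close> is generated by one power of the coset of
  \<open>x\<close>. A lift \<open>v\<close> of that power and generators of
  \<open>U \<inter> H\<close> together generate \<open>U\<close>.\<close>

lemma (in normal) finitely_generated_subgroups_insert:
  assumes fg: "\<And>U. \<lbrakk>subgroup U G; U \<subseteq> H\<rbrakk> \<Longrightarrow> finitely_generated_subgroup G U"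
    and x: "x \<in> carrier G" and U: "subgroup U G" "U \<subseteq> generate G (insert x H)"
  shows "finitely_generated_subgroup G U"
proof -
  interpret U: subgroup U G by (rule U)
  interpret Q: group "G Mod H" by (rule factorgroup_is_group)
  interpret p: group_hom G "G Mod H" "(#>) H"
    by (intro group_hom.intro group_hom_axioms.intro is_group Q.is_group r_coset_hom_Mod)
  have UH: "finitely_generated_subgroup G (U \<inter> H)"
    using U by (intro fg subgroups_Inter_pair subgroup_axioms) auto
  have in_H: "w \<in> H" if "w \<in> carrier G" "H #> w = \<one>\<^bsub>G Mod H\<^esub>" for w
    using that rcos_self[OF that(1) subgroup_axioms] by simp
  let ?X = "H #> x"
  have expo: "\<exists>k::int. H #> u = ?X [^]\<^bsub>G Mod H\<^esub> k" if "u \<in> U" for u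
  proof -
    have "u \<in> {h \<otimes> x [^] k | h (k::int). h \<in> H}"
      using that U(2) generate_insert_eq[OF subgroup_axioms x] x inv_op_closed1 inv_op_closed2 by blast
    then obtain h k where hk: "h \<in> H" "u = h \<otimes> x [^] (k::int)" by blast
    have "H #> h = \<one>\<^bsub>G Mod H\<^esub>" using hk(1) rcos_const by simp
    moreover have "H #> u = (H #> h) \<otimes>\<^bsub>G Mod H\<^esub> ?X [^]\<^bsub>G Mod H\<^esub> k"
      using hk x p.hom_mult[of h "x [^] k"] p.hom_int_pow[OF x] by simp
    ultimately have "H #> u = ?X [^]\<^bsub>G Mod H\<^esub> k" using p.hom_closed[OF x] by (metis Q.int_pow_closed Q.l_one)
    then show ?thesis by blast
  qed
  \<comment> \<open>The exponents of those powers of \<open>?X\<close> that lie in the image of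
    \<open>U\<close>. An element of \<open>U\<close> may have several exponents, as
    \<open>?X\<close> may have finite order.\<close>
  define E where "E = {k::int. \<exists>u\<in>U. H #> u = ?X [^]\<^bsub>G Mod H\<^esub> k}"
  have X: "?X \<in> carrier (G Mod H)" using x by simp
  show ?thesis
  proof (cases "E \<subseteq> {0}")
    case True
    have "U \<subseteq> H"
    proof
      fix u assume u: "u \<in> U"
      from expo[OF u] obtain k :: int where k: "H #> u = ?X [^]\<^bsub>G Mod H\<^esub> k" ..
      then have "k = 0" using True u by (auto simp: E_def)
      then show "u \<in> H" using k in_H u by simp
    qed
    then show ?thesis using U fg by blast
  next
    case False
    \<comment> \<open>This one closure property yields zero, negatives and remainders on division,
      so \<open>E\<close> consists of multiples of its least positive element
      \<open>d\<close>.\<close>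
    have Emult: "k - l * q \<in> E" if kl: "k \<in> E" "l \<in> E" for k l q
    proof -
      obtain u v where uv: "u \<in> U" "H #> u = ?X [^]\<^bsub>G Mod H\<^esub> k"
        "v \<in> U" "H #> v = ?X [^]\<^bsub>G Mod H\<^esub> l" using kl by (auto simp: E_def)
      have "u \<otimes> inv (v [^] q) \<in> U" using uv subgroup_int_pow_closed[OF U(1)] by auto
      moreover have "H #> (u \<otimes> inv (v [^] q)) = ?X [^]\<^bsub>G Mod H\<^esub> (k - l * q)"
        using uv X by (simp add: p.hom_int_pow Q.int_pow_pow Q.int_pow_diff)
      ultimately show ?thesis unfolding E_def by blast
    qed
    have "\<exists>n. n > 0 \<and> int n \<in> E"
    proof -
      obtain k where k: "k \<in> E" "k \<noteq> 0" using False by blast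
      then have "0 \<in> E" using Emult[OF k(1) k(1), of 1] by simp
      then have "-k \<in> E" using Emult[of 0 k 1] k by simp
      then have "int (nat \<bar>k\<bar>) \<in> E" using k by (cases "k \<ge> 0") auto
      then show ?thesis using k by (intro exI[of _ "nat \<bar>k\<bar>"]) auto
    qed
    define d where "d = (LEAST n. n > 0 \<and> int n \<in> E)"
    have d: "d > 0" "int d \<in> E"
      using LeastI_ex[OF \<open>\<exists>n. n > 0 \<and> int n \<in> E\<close>] by (auto simp: d_def)
    have dvd: "int d dvd k" if "k \<in> E" for k
    proof (rule ccontr)
      assume "\<not> int d dvd k"
      then have "k mod int d > 0" using d(1) by (simp add: mod_eq_0_iff_dvd order_le_neq_trans pos_mod_sign)
      moreover have "k mod int d \<in> E"
        using Emult[OF that d(2), of "k div int d"] by (simp add: minus_mult_div_eq_mod)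
      ultimately have "d \<le> nat (k mod int d)" unfolding d_def by (intro Least_le) auto
      then show False using d(1) pos_mod_bound[of "int d" k] by linarith
    qed
    obtain v where v: "v \<in> U" "H #> v = ?X [^]\<^bsub>G Mod H\<^esub> int d" using d by (auto simp: E_def)
    \<comment> \<open>If \<open>u\<close> has exponent d q, then u v^-q lies in
      \<open>U \<inter> H\<close>.\<close>
    have "U = generate G (insert v (U \<inter> H))"
    proof (rule generateI[OF U(1)])
      show "insert v (U \<inter> H) \<subseteq> U" using v by auto
      fix K assume K: "subgroup K G" "insert v (U \<inter> H) \<subseteq> K"
      show "U \<subseteq> K"
      proof
        fix u assume u: "u \<in> U"
        from expo[OF u] obtain k :: int where k: "H #> u = ?X [^]\<^bsub>G Mod H\<^esub> k" ..
        then obtain q where q: "k = int d * q" using dvd u by (auto simp: E_def dvd_def)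
        have w: "u \<otimes> inv (v [^] q) \<in> U" using u v subgroup_int_pow_closed[OF U(1)] by auto
        have "H #> (u \<otimes> inv (v [^] q)) = \<one>\<^bsub>G Mod H\<^esub>"
          using u v k q X
          by (simp add: p.hom_int_pow Q.int_pow_pow del: mult_FactGroup one_FactGroup carrier_FactGroup)
        then have "u \<otimes> inv (v [^] q) \<in> K" using in_H w K by auto
        moreover have "v [^] q \<in> K" using subgroup_int_pow_closed[OF K(1)] K by auto
        ultimately have "u \<otimes> inv (v [^] q) \<otimes> v [^] q \<in> K" using subgroup.m_closed[OF K(1)] by blast
        then show "u \<in> K" using u v by (simp add: m_assoc)
      qed
    qed
    then show ?thesis using finitely_generated_subgroup_insert[OF UH, of v] v by simp
  qed
qed

section \<open>The lower central series\<close>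

declare lower_central.simps(2) [simp del]

text \<open>Normality of term \<open>n\<close> puts the generating commutators of the next term
  inside term \<open>n\<close>. The next term is then normal by y a y^-1 = a [a^-1, y]: as a^-1 lies
  in term \<open>n\<close>, the commutator is one of its generators.\<close>

lemma (in group) lower_central_normal: "lower_central G n \<lhd> G"
  and lower_central_Suc_subset: "lower_central G (Suc n) \<subseteq> lower_central G n"
  and lower_central_subset_center_mod: "lower_central G n \<subseteq> center_mod G (lower_central G (Suc n))"
proof -
  have *: "lower_central G (Suc n) \<lhd> G \<and> lower_central G (Suc n) \<subseteq> lower_central G n \<and>
           lower_central G n \<subseteq> center_mod G (lower_central G (Suc n))"
    if N: "lower_central G n \<lhd> G" for n
  proof -
    interpret N: normal "lower_central G n" G by (rule N)
    let ?C = "{x \<otimes> y \<otimes> inv x \<otimes> inv y | x y. x \<in> lower_central G n \<and> y \<in> carrier G}"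
    have C: "?C \<subseteq> lower_central G n"
      using N.subset_center_mod by (auto simp: center_mod_def centralizer_mod_def)
    then have CG: "?C \<subseteq> carrier G" using N.subset by blast
    have sub: "lower_central G (Suc n) \<subseteq> lower_central G n"
      using C generate_subgroup_incl[OF _ N.subgroup_axioms] by (simp add: lower_central.simps(2))
    have cen: "lower_central G n \<subseteq> center_mod G (lower_central G (Suc n))"
      by (auto simp: center_mod_def centralizer_mod_def lower_central.simps(2) intro!: generate.incl)
    have "lower_central G (Suc n) \<lhd> G"
    proof (rule normal_invI)
      show S: "subgroup (lower_central G (Suc n)) G" using generate_is_subgroup[OF CG] by (simp add: lower_central.simps(2))
      fix y a assume ya: "y \<in> carrier G" "a \<in> lower_central G (Suc n)"
      have a: "inv a \<in> lower_central G (Suc n)" using subgroup.m_inv_closed[OF S] ya by blast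
      have aG: "a \<in> carrier G" using subgroup.mem_carrier[OF S] ya by blast
      have "inv a \<in> lower_central G n" using a sub by blast
      then have "inv a \<in> centralizer_mod G (lower_central G (Suc n)) y"
        using cen ya(1) by (auto simp: center_mod_def)
      then have "inv a \<otimes> y \<otimes> a \<otimes> inv y \<in> lower_central G (Suc n)"
        using aG by (simp add: centralizer_mod_def)
      then have "a \<otimes> (inv a \<otimes> y \<otimes> a \<otimes> inv y) \<in> lower_central G (Suc n)"
        using subgroup.m_closed[OF S] ya by blast
      then show "y \<otimes> a \<otimes> inv y \<in> lower_central G (Suc n)" using aG ya(1) by (simp add: word_simps)
    qed
    then show ?thesis using sub cen by blast
  qed
  show N: "lower_central G n \<lhd> G" for n
  proof (induction n)
    case 0
    then show ?case using normal_invI[OF subgroup_self] by simp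
  next
    case (Suc n)
    then show ?case using * by blast
  qed
  show "lower_central G (Suc n) \<subseteq> lower_central G n"
    "lower_central G n \<subseteq> center_mod G (lower_central G (Suc n))"
    using * N by blast+
qed

text \<open>Each factor of the series is finitely generated: if \<open>X\<close> generates term
  \<open>n\<close> modulo the next one, then the commutators of \<open>X\<close> with
  \<open>Y\<close> generate the next term modulo its successor.\<close>

lemma (in group) lower_central_finitely_generated_mod:
  assumes Y: "finite Y" "Y \<subseteq> carrier G" "generate G Y = carrier G"
  shows "\<exists>X. finite X \<and> X \<subseteq> lower_central G n \<and>
             lower_central G n = generate G (X \<union> lower_central G (Suc n))"
proof (induction n)
  case 0
  have "carrier G \<subseteq> generate G (Y \<union> lower_central G (Suc 0))"
    using mono_generate[of Y "Y \<union> lower_central G (Suc 0)"] Y by blast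
  moreover have "generate G (Y \<union> lower_central G (Suc 0)) \<subseteq> carrier G"
    using Y lower_central_Suc_subset[of 0] by (intro generate_incl) auto
  ultimately show ?case using Y by (intro exI[of _ Y]) auto
next
  case (Suc n)
  then obtain X where X: "finite X" "X \<subseteq> lower_central G n"
    "lower_central G n = generate G (X \<union> lower_central G (Suc n))" by blast
  define X' where "X' = (\<lambda>(x, y). x \<otimes> y \<otimes> inv x \<otimes> inv y) ` (X \<times> Y)"
  \<comment> \<open>The candidate for term \<open>Suc n\<close>. It is normal because it lies
    between two consecutive terms of the series.\<close>
  define Q where "Q = generate G (X' \<union> lower_central G (Suc (Suc n)))"
  interpret N: normal "lower_central G n" G by (rule lower_central_normal)
  interpret N1: normal "lower_central G (Suc n)" G by (rule lower_central_normal)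
  interpret N2: normal "lower_central G (Suc (Suc n))" G by (rule lower_central_normal)
  have X': "X' \<subseteq> lower_central G (Suc n)"
  proof
    fix c assume "c \<in> X'"
    then obtain x y where c: "x \<in> X" "y \<in> Y" "c = x \<otimes> y \<otimes> inv x \<otimes> inv y"
      unfolding X'_def by auto
    then have "x \<in> center_mod G (lower_central G (Suc n))" "y \<in> carrier G"
      using X(2) Y(2) lower_central_subset_center_mod[of n] by blast+
    then have "x \<in> centralizer_mod G (lower_central G (Suc n)) y"
      by (simp add: center_mod_def)
    then show "c \<in> lower_central G (Suc n)" using c(3) by (simp add: centralizer_mod_def)
  qed
  have gen: "X' \<union> lower_central G (Suc (Suc n)) \<subseteq> lower_central G (Suc n)"
    using X' lower_central_Suc_subset by blast
  have Q1: "Q \<subseteq> lower_central G (Suc n)"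
    unfolding Q_def by (rule generate_subgroup_incl[OF gen N1.subgroup_axioms])
  have Q2: "lower_central G (Suc (Suc n)) \<subseteq> Q" unfolding Q_def by (blast intro: generate.incl)
  have "subgroup Q G"
    unfolding Q_def by (rule generate_is_subgroup) (use gen N1.subset in blast)
  then interpret Q: normal Q G
    using N2.normal_between_center_mod[of Q] Q1 Q2 lower_central_subset_center_mod by blast
  \<comment> \<open>This puts all generating commutators of term \<open>Suc n\<close> into
    \<open>Q\<close>. It suffices to test against \<open>Y\<close>: elements of \<open>X\<close>
    pass by the choice of \<open>X'\<close>, and those of term \<open>Suc n\<close> are already
    central modulo term \<open>Suc (Suc n)\<close>.\<close>
  have "lower_central G n \<subseteq> center_mod G Q"
  proof
    fix x assume x: "x \<in> lower_central G n"
    show "x \<in> center_mod G Q"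
    proof (rule Q.center_modI_generate[OF Y(2,3)])
      show "x \<in> carrier G" using x by simp
      fix y assume y: "y \<in> Y"
      then have yG: "y \<in> carrier G" using Y by blast
      have "X \<subseteq> centralizer_mod G Q y"
      proof
        fix a assume a: "a \<in> X"
        then have "a \<otimes> y \<otimes> inv a \<otimes> inv y \<in> Q"
          using y unfolding Q_def by (intro generate.incl) (force simp: X'_def)
        then show "a \<in> centralizer_mod G Q y" using a X by (auto simp: centralizer_mod_def)
      qed
      moreover have "lower_central G (Suc n) \<subseteq> centralizer_mod G Q y"
      proof -
        have "lower_central G (Suc n) \<subseteq> center_mod G Q"
          using lower_central_subset_center_mod[of "Suc n"] N2.center_mod_mono[OF Q2] by blast
        then show ?thesis using yG unfolding center_mod_def by blast
      qed
      ultimately have "generate G (X \<union> lower_central G (Suc n)) \<subseteq> centralizer_mod G Q y"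
        using Q.subgroup_centralizer_mod[OF yG] by (intro generate_subgroup_incl) auto
      then show "x \<in> centralizer_mod G Q y" using x X(3) by blast
    qed
  qed
  then have "x \<in> centralizer_mod G Q y" if "x \<in> lower_central G n" "y \<in> carrier G" for x y
    using that by (auto simp: center_mod_def)
  then have "x \<otimes> y \<otimes> inv x \<otimes> inv y \<in> Q" if "x \<in> lower_central G n" "y \<in> carrier G" for x y
    using that by (simp add: centralizer_mod_def)
  then have "{x \<otimes> y \<otimes> inv x \<otimes> inv y | x y. x \<in> lower_central G n \<and> y \<in> carrier G} \<subseteq> Q"
    by blast
  then have "lower_central G (Suc n) \<subseteq> Q"
    unfolding lower_central.simps(2) by (rule generate_subgroup_incl[OF _ Q.subgroup_axioms])
  then have "lower_central G (Suc n) = Q" using Q1 by blast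
  moreover have "finite X'" using X Y by (simp add: X'_def)
  ultimately show ?case using X' unfolding Q_def by (intro exI[of _ X'] conjI)
qed

text \<open>The series refines to a chain of normal subgroups with cyclic factors, and finite
  generation of all subgroups passes up through each factor.\<close>

lemma (in group) nilpotent_finitely_generated_subgroups:
  assumes fg: "finitely_generated_group G" and nil: "nilpotent_group G" and U: "subgroup U G"
  shows "finitely_generated_subgroup G U"
proof -
  obtain Y where Y: "finite Y" "Y \<subseteq> carrier G" "generate G Y = carrier G"
    using fg finitely_generated_subgroupE unfolding finitely_generated_group_def by metis
  obtain c where c: "lower_central G c = {\<one>}" using nil by (auto simp: nilpotent_group_def)
  \<comment> \<open>Increasing \<open>i\<close> climbs from the trivial term to the whole group,
    reached at \<open>i = c\<close>. Beyond that the truncated subtraction makes the step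
    void.\<close>
  have "\<forall>U. subgroup U G \<longrightarrow> U \<subseteq> lower_central G (c - i) \<longrightarrow> finitely_generated_subgroup G U" for i
  proof (induction i)
    case 0
    have "U = {\<one>}" if "subgroup U G" "U \<subseteq> {\<one>}" for U
      using that subgroup.one_closed by blast
    moreover have "finitely_generated_subgroup G {\<one>}"
      by (intro finitely_generated_subgroupI[of "{}"]) (auto simp: generate_empty)
    ultimately show ?case using c by auto
  next
    case (Suc i)
    show ?case
    proof (cases "c \<le> i")
      case True
      then show ?thesis using Suc by simp
    next
      case False
      define m where "m = c - Suc i"
      have m: "c - i = Suc m" using False by (simp add: m_def)
      obtain X where X: "finite X" "X \<subseteq> lower_central G m"
        "lower_central G m = generate G (X \<union> lower_central G (Suc m))"
        using lower_central_finitely_generated_mod[OF Y] by blast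
      interpret N: normal "lower_central G m" G by (rule lower_central_normal)
      interpret N1: normal "lower_central G (Suc m)" G by (rule lower_central_normal)
      \<comment> \<open>The generators in \<open>X\<close> are added one at a time. Each
        intermediate group \<open>A\<close> is normal, since term \<open>m\<close> is central modulo
        term \<open>Suc m\<close>, so each step is a cyclic extension.\<close>
      have "\<forall>U. subgroup U G \<longrightarrow> U \<subseteq> generate G (X \<union> lower_central G (Suc m)) \<longrightarrow>
              finitely_generated_subgroup G U"
        using X(1,2)
      proof (induction X rule: finite_induct)
        case empty
        then show ?case
          using Suc m generate_subgroup_incl[OF subset_refl N1.subgroup_axioms] by fastforce
      next
        case (insert x X)
        define A where "A = generate G (X \<union> lower_central G (Suc m))"
        have gen: "X \<union> lower_central G (Suc m) \<subseteq> lower_central G m"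
          using insert lower_central_Suc_subset by blast
        then have "A \<subseteq> lower_central G m"
          unfolding A_def by (rule generate_subgroup_incl[OF _ N.subgroup_axioms])
        moreover have A: "subgroup A G"
          unfolding A_def by (rule generate_is_subgroup) (use gen N.subset in blast)
        moreover have "lower_central G (Suc m) \<subseteq> A" unfolding A_def by (blast intro: generate.incl)
        ultimately interpret A: normal A G
          using N1.normal_between_center_mod[of A] lower_central_subset_center_mod by blast
        have x: "x \<in> carrier G" using insert N.subset by blast
        have "X \<union> lower_central G (Suc m) \<subseteq> A" unfolding A_def by (blast intro: generate.incl)
        then have "generate G (insert x X \<union> lower_central G (Suc m)) \<subseteq> generate G (insert x A)"
          by (intro mono_generate) blast
        then have "U \<subseteq> generate G (insert x A)"
          if "U \<subseteq> generate G (insert x X \<union> lower_central G (Suc m))" for U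
          using that by (rule subset_trans[rotated])
        moreover have "finitely_generated_subgroup G U" if "subgroup U G" "U \<subseteq> A" for U
          using insert that unfolding A_def by simp
        ultimately show ?case using A.finitely_generated_subgroups_insert[OF _ x] by simp
      qed
      then show ?thesis using X(3) m_def by simp
    qed
  qed
  from this[of c] show ?thesis using U subgroup.subset[OF U] by simp
qed

section \<open>The maximal condition and central elements of infinite order\<close>

text \<open>Zorn's lemma applies because the union of a chain of subgroups is a subgroup whose
  finitely many generators lie in one member, so the union equals that member.\<close>

lemma (in group) maximal_subgroup_in_family:
  assumes fg: "\<And>U. subgroup U G \<Longrightarrow> finitely_generated_subgroup G U"
    and \<A>: "\<A> \<noteq> {}" "\<And>U. U \<in> \<A> \<Longrightarrow> subgroup U G"
  obtains M where "M \<in> \<A>" "\<And>U. \<lbrakk>U \<in> \<A>; M \<subseteq> U\<rbrakk> \<Longrightarrow> U = M"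
proof -
  have "\<Union>\<C> \<in> \<A>" if \<C>: "\<C> \<noteq> {}" "subset.chain \<A> \<C>" for \<C>
  proof -
    have \<C>\<A>: "\<C> \<subseteq> \<A>" using \<C>(2) by (simp add: subset_chain_def)
    have sub: "subgroup A G" if "A \<in> \<C>" for A using that \<C>\<A> \<A>(2) by blast
    have "subgroup (\<Union>\<C>) G"
    proof (intro subgroup.intro)
      show "\<Union>\<C> \<subseteq> carrier G" using subgroup.subset[OF sub] by blast
      show "\<one> \<in> \<Union>\<C>" using \<C>(1) subgroup.one_closed[OF sub] by blast
      fix x assume x: "x \<in> \<Union>\<C>"
      then show "inv x \<in> \<Union>\<C>" using subgroup.m_inv_closed[OF sub] by blast
      fix y assume "y \<in> \<Union>\<C>"
      with x obtain A B where AB: "A \<in> \<C>" "x \<in> A" "B \<in> \<C>" "y \<in> B" by blast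
      then have "A \<subseteq> B \<or> B \<subseteq> A" using \<C>(2) by (auto simp: subset_chain_def)
      then obtain C where C: "C \<in> \<C>" "x \<in> C" "y \<in> C" using AB by blast
      then have "x \<otimes> y \<in> C" using subgroup.m_closed[OF sub[OF C(1)]] by simp
      then show "x \<otimes> y \<in> \<Union>\<C>" using C by blast
    qed
    then obtain S where S: "finite S" "S \<subseteq> \<Union>\<C>" "\<Union>\<C> = generate G S"
      using fg finitely_generated_subgroupE by metis
    then obtain W where W: "W \<in> \<C>" "S \<subseteq> W" using finite_subset_Union_chain \<C> by metis
    then have "generate G S \<subseteq> W" using \<C>\<A> \<A>(2) by (intro generate_subgroup_incl) auto
    then have "\<Union>\<C> = W" using S(3) W(1) by blast
    then show ?thesis using W(1) \<C>\<A> by blast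
  qed
  then show thesis using subset_Zorn_nonempty[OF \<A>(1)] that by metis
qed

text \<open>In terms of G/Z: an infinite finitely generated nilpotent group has a central element of
  infinite order. Here it is a power of some \<open>x\<close> that is central and of infinite order
  modulo a finite extension \<open>W\<close> of \<open>Z\<close>.\<close>

lemma (in group) nilpotent_center_mod_power_notin:
  assumes fg: "finitely_generated_group G" and nil: "nilpotent_group G"
    and Z: "Z \<lhd> G" "\<not> finite (rcosets Z)"
  obtains z where "z \<in> center_mod G Z" "\<And>k::nat. k > 0 \<Longrightarrow> z [^] k \<notin> Z"
proof -
  interpret Z: normal Z G by (rule Z)
  obtain Y where Y: "finite Y" "Y \<subseteq> carrier G" "generate G Y = carrier G"
    using fg finitely_generated_subgroupE unfolding finitely_generated_group_def by metis
  \<comment> \<open>Take \<open>W\<close> maximal with \<open>W/Z\<close> finite; then nothing outside \<open>W\<close> that is central modulo \<open>W\<close>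
    has finite order modulo \<open>W\<close>.\<close>
  define \<A> where "\<A> = {W. W \<lhd> G \<and> Z \<subseteq> W \<and> finite ((#>) Z ` W)}"
  have "(#>) Z ` Z \<subseteq> {Z}" using Z.rcos_const by auto
  then have "Z \<in> \<A>" using Z(1) finite_subset by (auto simp: \<A>_def)
  then have "\<A> \<noteq> {}" by blast
  then obtain W where W: "W \<in> \<A>" and max: "\<And>U. \<lbrakk>U \<in> \<A>; W \<subseteq> U\<rbrakk> \<Longrightarrow> U = W"
    using maximal_subgroup_in_family[of \<A>] nilpotent_finitely_generated_subgroups[OF fg nil]
      normal_imp_subgroup by (metis (no_types, lifting) \<A>_def mem_Collect_eq)
  then interpret W: normal W G by (simp add: \<A>_def)
  have ZW: "Z \<subseteq> W" and finW: "finite ((#>) Z ` W)" using W by (auto simp: \<A>_def)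
  have "(#>) Z ` carrier G = rcosets Z" by (auto simp: RCOSETS_def)
  then have "W \<noteq> carrier G" using finW Z(2) by auto
  obtain c where "lower_central G c = {\<one>}" using nil by (auto simp: nilpotent_group_def)
  then have "\<exists>n. lower_central G n \<subseteq> W" by (intro exI[of _ c]) auto
  \<comment> \<open>With \<open>n\<close> least, the term just before it contains some
    \<open>x\<close> outside \<open>W\<close>, and this term is central modulo
    \<open>W\<close>.\<close>
  then obtain n where n: "lower_central G n \<subseteq> W" "\<And>m. m < n \<Longrightarrow> \<not> lower_central G m \<subseteq> W"
    using exists_least_iff[of "\<lambda>n. lower_central G n \<subseteq> W"] by blast
  have "n \<noteq> 0" using n(1) \<open>W \<noteq> carrier G\<close> W.subset by (intro notI) auto
  then obtain m where m: "n = Suc m" by (cases n) auto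
  then obtain x where x: "x \<in> lower_central G m" "x \<notin> W" using n(2)[of m] by auto
  interpret L: normal "lower_central G n" G by (rule lower_central_normal)
  have xcen: "x \<in> center_mod G W"
    using x(1) lower_central_subset_center_mod[of m] L.center_mod_mono[OF n(1)] m by blast
  then have xG: "x \<in> carrier G" by (simp add: center_mod_def)
  \<comment> \<open>Otherwise \<open>W\<close> and \<open>x\<close> would generate a strictly larger
    normal subgroup \<open>V\<close> with V/Z finite.\<close>
  have x_pow: "x [^] k \<notin> W" if k: "k > 0" for k :: nat
  proof
    assume xk: "x [^] k \<in> W"
    define V where "V = generate G (insert x W)"
    have V_eq: "V = {w \<otimes> x [^] l | w (l::int). w \<in> W}"
      unfolding V_def using xG W.inv_op_closed1 W.inv_op_closed2
      by (intro generate_insert_eq W.subgroup_axioms) auto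
    have WV: "W \<subseteq> V" "x \<in> V" unfolding V_def by (auto intro: generate.incl)
    have V: "subgroup V G"
      unfolding V_def using xG W.subset by (intro generate_is_subgroup) auto
    moreover have "V \<subseteq> center_mod G W"
      unfolding V_def using W.subset_center_mod xcen
      by (intro generate_subgroup_incl W.subgroup_center_mod) auto
    ultimately have "V \<lhd> G" using WV by (intro W.normal_between_center_mod)
    \<comment> \<open>Reducing the exponent modulo \<open>k\<close> moves a power of x^k into
      \<open>W\<close>, so only the exponents below \<open>k\<close> are needed.\<close>
    have "(#>) Z ` V \<subseteq> (\<lambda>(D, r). D #> x [^] r) ` ((#>) Z ` W \<times> {0..<int k})"
    proof
      fix D assume "D \<in> (#>) Z ` V"
      then obtain w l where wl: "w \<in> W" "D = Z #> (w \<otimes> x [^] (l::int))" using V_eq by auto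
      define w' where "w' = w \<otimes> (x [^] int k) [^] (l div int k)"
      have "(x [^] int k) [^] (l div int k) \<in> W"
        using subgroup_int_pow_closed[OF W.subgroup_axioms, of "x [^] int k"] xk
        by (simp add: int_pow_int)
      then have w': "w' \<in> W" using wl by (simp add: w'_def)
      have "w \<otimes> x [^] l = w' \<otimes> x [^] (l mod int k)"
        using wl xG by (simp add: w'_def int_pow_pow m_assoc flip: int_pow_mult)
      then have "D = (Z #> w') #> x [^] (l mod int k)"
        using wl w' xG Z.subset by (simp add: coset_mult_assoc)
      moreover have "l mod int k \<in> {0..<int k}" using k by simp
      ultimately show "D \<in> (\<lambda>(D, r). D #> x [^] r) ` ((#>) Z ` W \<times> {0..<int k})"
        using w' by blast
    qed
    then have "finite ((#>) Z ` V)" by (rule finite_subset) (use finW in simp)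
    then have "V \<in> \<A>" using \<open>V \<lhd> G\<close> ZW WV by (auto simp: \<A>_def)
    then show False using max WV x(2) by blast
  qed
  \<comment> \<open>Some power of \<open>x\<close> is central modulo \<open>Z\<close> and not only modulo \<open>W\<close>: as \<open>W/Z\<close> is finite,
    the conjugates of the finitely many generators by the powers of \<open>x\<close> take finitely many
    values modulo \<open>Z\<close>.\<close>
  define f where "f i = (\<lambda>y\<in>Y. Z #> (x [^] i \<otimes> y \<otimes> inv (x [^] i)))" for i :: nat
  define F where "F = (\<lambda>(D, y). D #> y) ` ((#>) Z ` W \<times> Y)"
  have "f i \<in> Y \<rightarrow>\<^sub>E F" for i
  proof -
    have "Z #> (x [^] i \<otimes> y \<otimes> inv (x [^] i)) \<in> F" if y: "y \<in> Y" for y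
    proof -
      have yG: "y \<in> carrier G" using y Y by blast
      have "x [^] int i \<in> center_mod G W"
        using subgroup_int_pow_closed[OF W.subgroup_center_mod xcen] .
      then have w: "x [^] i \<otimes> y \<otimes> inv (x [^] i) \<otimes> inv y \<in> W" (is "?w \<in> W")
        using yG by (simp add: center_mod_def centralizer_mod_def int_pow_int)
      have "x [^] i \<otimes> y \<otimes> inv (x [^] i) = ?w \<otimes> y" using xG yG by (simp add: word_simps)
      then have "Z #> (x [^] i \<otimes> y \<otimes> inv (x [^] i)) = (Z #> ?w) #> y"
        using w yG xG Z.subset by (simp add: coset_mult_assoc)
      then show ?thesis using w y unfolding F_def by blast
    qed
    then show ?thesis by (auto simp: f_def)
  qed
  moreover have "finite (Y \<rightarrow>\<^sub>E F)" using Y finW by (intro finite_PiE) (auto simp: F_def)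
  ultimately have "finite (range f)" by (meson finite_subset image_subsetI)
  then have "\<not> inj f" using finite_imageD infinite_UNIV_nat by blast
  then obtain i j where ij: "i < j" "f i = f j"
    unfolding inj_def by (metis linorder_neqE_nat)
  \<comment> \<open>x^i and x^j conjugate every generator to the same coset of \<open>Z\<close>, so
    their quotient commutes with the generators modulo \<open>Z\<close>.\<close>
  define z where "z = x [^] (j - i)"
  have zG: "z \<in> carrier G" using xG by (simp add: z_def)
  have xj: "x [^] j = x [^] i \<otimes> z" using ij xG by (simp add: z_def nat_pow_mult)
  have "z \<in> center_mod G Z"
  proof (rule Z.center_modI_generate[OF Y(2,3) zG])
    fix y assume y: "y \<in> Y"
    then have yG: "y \<in> carrier G" using Y by blast
    let ?u = "x [^] i \<otimes> y \<otimes> inv (x [^] i)" and ?v = "x [^] j \<otimes> y \<otimes> inv (x [^] j)"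
    have uv: "?u \<in> carrier G" "?v \<in> carrier G" using xG yG by auto
    have "Z #> ?v = Z #> ?u" using fun_cong[OF ij(2), of y] y by (simp add: f_def)
    then have "?v \<in> Z #> ?u" using rcos_self[OF uv(2) Z.subgroup_axioms] by simp
    then have "?v \<otimes> inv ?u \<in> Z" using Z.rcos_module_imp[OF is_group uv(1)] by blast
    \<comment> \<open>The product v u^-1 equals x^i [z, y] x^-i, so conjugating back leaves
      [z, y].\<close>
    then have "inv (x [^] i) \<otimes> (?v \<otimes> inv ?u) \<otimes> x [^] i \<in> Z"
      using xG by (intro Z.inv_op_closed1) auto
    then show "z \<in> centralizer_mod G Z y"
      using xG yG zG unfolding xj by (simp add: word_simps centralizer_mod_def)
  qed
  moreover have "z [^] k \<notin> Z" if "k > 0" for k :: nat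
    using x_pow[of "(j - i) * k"] that ij ZW xG by (auto simp: z_def nat_pow_pow)
  ultimately show thesis by (rule that)
qed

section \<open>Double cosets\<close>

text \<open>c u c^-1 = [c, u] u with [c, u] in \<open>H\<close>: an element central modulo
  \<open>H\<close> normalizes every subgroup containing \<open>H\<close>.\<close>

lemma (in normal) center_mod_conj:
  assumes c: "c \<in> center_mod G H" and A: "subgroup A G" "H \<subseteq> A" and u: "u \<in> A"
  shows "c \<otimes> u \<otimes> inv c \<in> A" "inv c \<otimes> u \<otimes> c \<in> A"
proof -
  interpret A: subgroup A G by (rule A)
  have *: "c \<otimes> u \<otimes> inv c \<in> A" if c: "c \<in> center_mod G H" for c
  proof -
    have "c \<otimes> u \<otimes> inv c \<otimes> inv u \<in> A"
      using c u A(2) by (auto simp: center_mod_def centralizer_mod_def)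
    then have "c \<otimes> u \<otimes> inv c \<otimes> inv u \<otimes> u \<in> A" using u by (rule A.m_closed)
    then show ?thesis using c u by (simp add: word_simps center_mod_def)
  qed
  show "c \<otimes> u \<otimes> inv c \<in> A" using * c .
  have "inv c \<in> center_mod G H" using subgroup.m_inv_closed[OF subgroup_center_mod c] .
  then show "inv c \<otimes> u \<otimes> c \<in> A" using *[of "inv c"] c by (simp add: center_mod_def)
qed

text \<open>As \<open>z\<close> normalizes \<open>A\<close>, the exponents \<open>d\<close> with z^d
  in AB form a subgroup of the integers. If \<open>x\<close> lies in A z^k B, then \<open>k\<close>
  is not in this subgroup, and \<open>j\<close> is chosen so that no k - j l is in it.\<close>

lemma (in normal) double_coset_avoiding_power:
  assumes A: "subgroup A G" "H \<subseteq> A" and B: "subgroup B G"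
    and z: "z \<in> center_mod G H" and x: "x \<notin> A <#> B"
  obtains j :: nat where "j > 0" "x \<notin> generate G (insert (z [^] j) A) <#> B"
proof -
  interpret A: subgroup A G by (rule A)
  interpret B: subgroup B G by (rule B)
  have zG: "z \<in> carrier G" using z by (simp add: center_mod_def)
  \<comment> \<open>\<open>R k l\<close> says that z^k and z^l lie in the same double coset of
    \<open>A\<close> and \<open>B\<close>.\<close>
  define R where "R k l \<longleftrightarrow> (\<exists>a\<in>A. \<exists>b\<in>B. z [^] k = a \<otimes> z [^] l \<otimes> b)" for k l :: int
  have conj: "z [^] k \<otimes> a \<otimes> inv (z [^] k) \<in> A" if "a \<in> A" for k :: int and a
    using center_mod_conj(1)[OF subgroup_int_pow_closed[OF subgroup_center_mod z] A that] .
  have RI: "R k l" if "a \<in> A" "b \<in> B" "z [^] k = a \<otimes> z [^] l \<otimes> b" for a b k l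
    using that unfolding R_def by blast
  have sym: "R l k" if "R k l" for k l
  proof -
    obtain a b where ab: "a \<in> A" "b \<in> B" "z [^] k = a \<otimes> z [^] l \<otimes> b" using \<open>R k l\<close> by (auto simp: R_def)
    then have "z [^] l = inv a \<otimes> z [^] k \<otimes> inv b" using zG by (simp add: word_simps)
    then show ?thesis using ab by (intro RI[of "inv a" "inv b"]) auto
  qed
  have trans: "R k m" if "R k l" "R l m" for k l m
  proof -
    obtain a b where ab: "a \<in> A" "b \<in> B" "z [^] k = a \<otimes> z [^] l \<otimes> b" using \<open>R k l\<close> by (auto simp: R_def)
    obtain a' b' where ab': "a' \<in> A" "b' \<in> B" "z [^] l = a' \<otimes> z [^] m \<otimes> b'"
      using \<open>R l m\<close> by (auto simp: R_def)
    have "z [^] k = (a \<otimes> a') \<otimes> z [^] m \<otimes> (b' \<otimes> b)" using ab ab' zG by (simp add: word_simps)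
    then show ?thesis using ab ab' by (intro RI[of "a \<otimes> a'" "b' \<otimes> b"]) auto
  qed
  \<comment> \<open>Here centrality of \<open>z\<close> modulo \<open>H\<close> enters: z^n can be
    moved past the factor from \<open>A\<close>.\<close>
  have shift: "R (k + n) (l + n)" if "R k l" for k l n
  proof -
    obtain a b where ab: "a \<in> A" "b \<in> B" "z [^] k = a \<otimes> z [^] l \<otimes> b" using \<open>R k l\<close> by (auto simp: R_def)
    have "z [^] (n + k) = (z [^] n \<otimes> a \<otimes> inv (z [^] n)) \<otimes> z [^] (n + l) \<otimes> b"
      using ab zG by (simp add: int_pow_mult word_simps)
    then show ?thesis using ab conj[of a n] by (intro RI) (auto simp: add.commute)
  qed
  have R_mult: "R (d * q) 0" if "R d 0" for d q
  proof (induction q rule: int_induct[where k = 0])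
    case base
    show ?case by (rule RI[of \<one> \<one>]) auto
  next
    case (step1 i)
    then show ?case using trans[OF shift[OF that, of "d * i"], of 0] by (simp add: algebra_simps)
  next
    case (step2 i)
    then show ?case using trans[OF shift[OF sym[OF that], of "d * (i - 1)"], of 0] by (simp add: algebra_simps)
  qed
  have gen: "\<exists>l b. b \<in> B \<and> (\<exists>a\<in>A. x = a \<otimes> z [^] (int j * l) \<otimes> b)"
    if xin: "x \<in> generate G (insert (z [^] j) A) <#> B" for j
  proof -
    have zj: "z [^] j \<in> center_mod G H"
      using subgroup_int_pow_closed[OF subgroup_center_mod z, of "int j"] by (simp add: int_pow_int)
    have "generate G (insert (z [^] j) A) = {u \<otimes> (z [^] j) [^] l | u (l::int). u \<in> A}"
      using zG center_mod_conj[OF zj A] by (intro generate_insert_eq A) auto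
    then obtain a l b where *: "a \<in> A" "b \<in> B" "x = a \<otimes> (z [^] j) [^] (l::int) \<otimes> b"
      using xin by (auto simp: set_mult_def)
    have "(z [^] j) [^] l = z [^] (int j * l)" using zG int_pow_pow[of z "int j" l] by (simp add: int_pow_int)
    then show ?thesis using * by auto
  qed
  show thesis
  proof (cases "x \<in> generate G (insert (z [^] (1::nat)) A) <#> B")
    case False
    then show ?thesis using that[of 1] by simp
  next
    case True
    then obtain k a b where k: "b \<in> B" "a \<in> A" "x = a \<otimes> z [^] (int 1 * k) \<otimes> b" using gen by blast
    have not_R: "\<not> R k 0"
    proof
      assume "R k 0"
      then obtain a' b' where ab': "a' \<in> A" "b' \<in> B" "z [^] k = a' \<otimes> z [^] (0::int) \<otimes> b'"
        by (auto simp: R_def)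
      then have "x = (a \<otimes> a') \<otimes> (b' \<otimes> b)" using k zG by (simp add: word_simps)
      then show False using x k ab' by (auto simp: set_mult_def)
    qed
    have avoid: "R (k - int j * l) 0" if "b' \<in> B" "a' \<in> A" "x = a' \<otimes> z [^] (int j * l) \<otimes> b'" for j l a' b'
    proof -
      have "a \<otimes> z [^] k \<otimes> b = a' \<otimes> z [^] (int j * l) \<otimes> b'" using k that by simp
      then have "inv a \<otimes> (a \<otimes> z [^] k \<otimes> b) \<otimes> inv b = inv a \<otimes> (a' \<otimes> z [^] (int j * l) \<otimes> b') \<otimes> inv b"
        by simp
      then have "z [^] k = (inv a \<otimes> a') \<otimes> z [^] (int j * l) \<otimes> (b' \<otimes> inv b)"
        using k that zG by (simp add: word_simps)
      then have "R k (int j * l)" using k that by (intro RI[of "inv a \<otimes> a'" "b' \<otimes> inv b"]) auto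
      then show ?thesis using shift[of k "int j * l" "- (int j * l)"] by simp
    qed
    show ?thesis
    proof (cases "\<exists>d. d \<noteq> 0 \<and> R d 0")
      case True
      then obtain d where d: "d \<noteq> 0" "R d 0" by blast
      \<comment> \<open>All multiples of \<open>j\<close> are related to zero, so a difference k - j
        l related to zero would force \<open>R k 0\<close>.\<close>
      define j where "j = nat \<bar>d\<bar>"
      have "x \<notin> generate G (insert (z [^] j) A) <#> B"
      proof
        assume "x \<in> generate G (insert (z [^] j) A) <#> B"
        then obtain l where l: "R (k - int j * l) 0" using gen avoid by blast
        have "int j * l = d * (sgn d * l)" by (simp add: j_def sgn_if)
        then have "R (int j * l) 0" using R_mult[OF d(2)] by metis
        then have "R k 0" using trans[OF shift[OF l, of "int j * l"], of 0] by simp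
        then show False using not_R by blast
      qed
      then show ?thesis using that[of j] d by (simp add: j_def)
    next
      case False
      \<comment> \<open>Only zero is related to zero here. The added one makes \<open>j\<close>
        exceed \<bar>k\<bar>, so \<open>k\<close> could be a multiple of \<open>j\<close> only if it
        were zero.\<close>
      define j where "j = nat \<bar>k\<bar> + 1"
      have "x \<notin> generate G (insert (z [^] j) A) <#> B"
      proof
        assume "x \<in> generate G (insert (z [^] j) A) <#> B"
        then obtain l where l: "R (k - int j * l) 0" using gen avoid by blast
        then have "k - int j * l = 0" using False by blast
        then have "int j dvd k" by simp
        then have "k = 0" using dvd_imp_le_int[of k "int j"] by (auto simp: j_def)
        then show False using not_R R_mult[OF l, of 0] by simp
      qed
      then show ?thesis using that[of j] by (simp add: j_def)
    qed
  qed
qed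

section \<open>Passage to a finite index subgroup\<close>

lemma (in group) finite_index_transversal:
  assumes H: "subgroup H G" and M: "finite_index_subgroup G M"
  obtains T where "finite T" "T \<subseteq> H" "\<And>h. h \<in> H \<Longrightarrow> \<exists>t\<in>T. h \<otimes> inv t \<in> H \<inter> M"
proof -
  have sub: "subgroup M G" and fin: "finite (rcosets M)"
    using M by (auto simp: finite_index_subgroup_def)
  have HG: "H \<subseteq> carrier G" using H by (rule subgroup.subset)
  have "finite ((#>) M ` H)" by (rule finite_subset[OF _ fin]) (use HG in \<open>auto simp: RCOSETS_def\<close>)
  then obtain T where T: "finite T" "T \<subseteq> H" "(#>) M ` H = (#>) M ` T"
    using finite_subset_image[of _ "(#>) M" H] by (metis subset_refl)
  have "\<exists>t\<in>T. h \<otimes> inv t \<in> H \<inter> M" if h: "h \<in> H" for h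
  proof -
    obtain t where t: "t \<in> T" "M #> h = M #> t" using T(3) h by (metis imageE imageI)
    then have "h \<in> M #> t" using rcos_self[OF _ sub, of h] h HG by auto
    then have "h \<otimes> inv t \<in> M" using subgroup.rcos_module_imp[OF sub is_group] t T(2) HG by blast
    moreover have "h \<otimes> inv t \<in> H" using h t T(2) H by (meson subgroup.m_closed subgroup.m_inv_closed subsetD)
    ultimately show ?thesis using t by blast
  qed
  with T show thesis using that by blast
qed

lemma (in group) finitely_generated_subgroup_Int_finite_index:
  assumes H: "finitely_generated_subgroup G H" and M: "finite_index_subgroup G M"
  shows "finitely_generated_subgroup G (H \<inter> M)"
proof -
  have sub: "subgroup H G" "subgroup M G"
    using assms by (auto simp: finite_index_subgroup_def finitely_generated_subgroup_def)
  obtain T where "finite T" "T \<subseteq> H" "\<And>h. h \<in> H \<Longrightarrow> \<exists>t\<in>T. h \<otimes> inv t \<in> H \<inter> M"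
    using finite_index_transversal[OF sub(1) M] by blast
  then show ?thesis
    by (intro finitely_generated_subgroup_finite_index[OF H subgroups_Inter_pair[OF sub]]) auto
qed

text \<open>HK is a finite union of two-sided translates of the smaller product by coset
  representatives of \<open>H\<close> and \<open>K\<close>.\<close>

lemma (in group) separable_in_double_coset_finite_index:
  assumes H: "subgroup H G" and K: "subgroup K G" and M: "finite_index_subgroup G M"
    and sep: "separable_in G ((H \<inter> M) <#> (K \<inter> M))"
  shows "separable_in G (H <#> K)"
proof -
  interpret H: subgroup H G by (rule H)
  interpret K: subgroup K G by (rule K)
  obtain S where S: "finite S" "S \<subseteq> H" "\<And>h. h \<in> H \<Longrightarrow> \<exists>s\<in>S. h \<otimes> inv s \<in> H \<inter> M"
    using finite_index_transversal[OF H M] by blast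
  obtain T where T: "finite T" "T \<subseteq> K" "\<And>k. k \<in> K \<Longrightarrow> \<exists>t\<in>T. k \<otimes> inv t \<in> K \<inter> M"
    using finite_index_transversal[OF K M] by blast
  let ?D = "(H \<inter> M) <#> (K \<inter> M)"
  have "H <#> K = (\<Union>(s, t)\<in>S \<times> T. (inv s <# ?D) #> t)"
  proof (intro subset_antisym subsetI)
    fix y assume "y \<in> H <#> K"
    then obtain h k where hk: "h \<in> H" "k \<in> K" "y = h \<otimes> k" by (auto simp: set_mult_def)
    \<comment> \<open>The representatives are for right cosets but are needed on the left of
      \<open>h\<close>; applied to h^-1 they give h = s^-1 (s h) with s h in
      \<open>M\<close>.\<close>
    obtain s where s: "s \<in> S" "inv h \<otimes> inv s \<in> H \<inter> M" using S(3)[of "inv h"] hk by auto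
    obtain t where t: "t \<in> T" "k \<otimes> inv t \<in> K \<inter> M" using T(3)[of k] hk by auto
    have st: "s \<in> H" "t \<in> K" using s t S T by auto
    have "inv (inv h \<otimes> inv s) \<in> H \<inter> M"
      using s(2) M H.m_inv_closed subgroup.m_inv_closed by (auto simp: finite_index_subgroup_def)
    then have "s \<otimes> h \<in> H \<inter> M" using st hk by (simp add: word_simps)
    then have "(s \<otimes> h) \<otimes> (k \<otimes> inv t) \<in> ?D" using t by (auto simp: set_mult_def)
    then have "inv s \<otimes> ((s \<otimes> h) \<otimes> (k \<otimes> inv t)) \<otimes> t \<in> (inv s <# ?D) #> t"
      by (auto simp: l_coset_def r_coset_def)
    moreover have "inv s \<otimes> ((s \<otimes> h) \<otimes> (k \<otimes> inv t)) \<otimes> t = y"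
      using hk st by (simp add: word_simps)
    ultimately show "y \<in> (\<Union>(s, t)\<in>S \<times> T. (inv s <# ?D) #> t)" using s t by auto
  next
    fix y assume "y \<in> (\<Union>(s, t)\<in>S \<times> T. (inv s <# ?D) #> t)"
    then obtain s t h k where *: "s \<in> S" "t \<in> T" "h \<in> H" "k \<in> K" "y = inv s \<otimes> (h \<otimes> k) \<otimes> t"
      by (auto simp: set_mult_def l_coset_def r_coset_def)
    then have st: "s \<in> H" "t \<in> K" using S T by auto
    have "y = (inv s \<otimes> h) \<otimes> (k \<otimes> t)" using * st by (simp add: m_assoc)
    then show "y \<in> H <#> K" using * st by (auto simp: set_mult_def)
  qed
  moreover have "separable_in G ((inv s <# ?D) #> t)" if "s \<in> S" "t \<in> T" for s t
  proof -
    have "s \<in> carrier G" "t \<in> carrier G" using that S T by auto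
    then show ?thesis using sep by (intro separable_in_r_coset separable_in_l_coset) auto
  qed
  ultimately show ?thesis using S T by (auto intro!: separable_in_Union)
qed

text \<open>Inside \<open>L\<close> = G x Z, membership in the product of
  \<open>H \<inter> L\<close> and \<open>K \<inter> L\<close> depends only on the first coordinate,
  as \<open>H \<inter> L\<close> contains 1 x Z. The hypothesis on \<open>G\<close> applies to the
  projections.\<close>

lemma double_coset_separable_DirProd_finite_index:
  fixes G :: "('a, 'b) monoid_scheme" and N :: "('c, 'd) monoid_scheme"
  assumes G: "double_coset_separable G" and N: "group N" and Z: "finite_index_subgroup N Z"
    and H: "finitely_generated_subgroup (G \<times>\<times> N) H"
    and K: "finitely_generated_subgroup (G \<times>\<times> N) K" and ZH: "{\<one>\<^bsub>G\<^esub>} \<times> Z \<subseteq> H"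
  shows "separable_in (G \<times>\<times> N) (H <#>\<^bsub>G \<times>\<times> N\<^esub> K)"
proof -
  interpret G: group G using G by (simp add: double_coset_separable_def)
  interpret N: group N by (rule N)
  interpret P: group "G \<times>\<times> N" by (rule DirProd_group[OF G.is_group N])
  interpret f: group_hom "G \<times>\<times> N" G fst
    by (intro group_hom.intro group_hom_axioms.intro P.is_group G.is_group) (auto simp: hom_def mult_DirProd')
  interpret s: group_hom "G \<times>\<times> N" N snd
    by (intro group_hom.intro group_hom_axioms.intro P.is_group N) (auto simp: hom_def mult_DirProd')
  interpret Z: subgroup Z N using Z by (simp add: finite_index_subgroup_def)
  define L where "L = {p \<in> carrier (G \<times>\<times> N). snd p \<in> Z}"
  have L: "finite_index_subgroup (G \<times>\<times> N) L"
    unfolding L_def by (rule s.finite_index_subgroup_vimage[OF Z])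
  have HL: "finitely_generated_subgroup (G \<times>\<times> N) (H \<inter> L)"
    and KL: "finitely_generated_subgroup (G \<times>\<times> N) (K \<inter> L)"
    using H K L by (auto intro: P.finitely_generated_subgroup_Int_finite_index)
  interpret HL: subgroup "H \<inter> L" "G \<times>\<times> N" using HL by (simp add: finitely_generated_subgroup_def)
  interpret KL: subgroup "K \<inter> L" "G \<times>\<times> N" using KL by (simp add: finitely_generated_subgroup_def)
  have ZHL: "{\<one>\<^bsub>G\<^esub>} \<times> Z \<subseteq> H \<inter> L" using ZH by (auto simp: L_def)
  define D where "D = fst ` (H \<inter> L) <#>\<^bsub>G\<^esub> fst ` (K \<inter> L)"
  have "separable_in G D"
    using G f.finitely_generated_subgroup_img[OF HL] f.finitely_generated_subgroup_img[OF KL]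
    unfolding D_def double_coset_separable_def by blast
  then have "separable_in (G \<times>\<times> N) ({p \<in> carrier (G \<times>\<times> N). fst p \<in> D} \<inter> L)"
    by (intro P.separable_in_Int f.separable_in_vimage P.separable_in_finite_index L)
  also have "{p \<in> carrier (G \<times>\<times> N). fst p \<in> D} \<inter> L = (H \<inter> L) <#>\<^bsub>G \<times>\<times> N\<^esub> (K \<inter> L)"
  proof (intro subset_antisym subsetI)
    fix p assume "p \<in> {p \<in> carrier (G \<times>\<times> N). fst p \<in> D} \<inter> L"
    then obtain u v n where uv: "u \<in> H \<inter> L" "v \<in> K \<inter> L" "p = (fst u \<otimes>\<^bsub>G\<^esub> fst v, n)" "n \<in> Z"
      by (cases p) (auto simp: D_def L_def set_mult_def)
    then have uvZ: "snd u \<in> Z" "snd v \<in> Z" "fst u \<in> carrier G" "fst v \<in> carrier G"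
      by (auto simp: L_def)
    \<comment> \<open>The element of 1 x Z that corrects the second coordinate of u v to
      \<open>n\<close>.\<close>
    define w where "w = (\<one>\<^bsub>G\<^esub>, n \<otimes>\<^bsub>N\<^esub> inv\<^bsub>N\<^esub> snd v \<otimes>\<^bsub>N\<^esub> inv\<^bsub>N\<^esub> snd u)"
    have "w \<in> H \<inter> L" using uv uvZ by (intro subsetD[OF ZHL]) (auto simp: w_def)
    then have "w \<otimes>\<^bsub>G \<times>\<times> N\<^esub> u \<in> H \<inter> L" using uv(1) by (rule HL.m_closed)
    moreover have "p = (w \<otimes>\<^bsub>G \<times>\<times> N\<^esub> u) \<otimes>\<^bsub>G \<times>\<times> N\<^esub> v"
      using uv(3,4) uvZ by (simp add: w_def mult_DirProd' N.word_simps)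
    ultimately show "p \<in> (H \<inter> L) <#>\<^bsub>G \<times>\<times> N\<^esub> (K \<inter> L)" using uv(2) unfolding set_mult_def by blast
  next
    fix p assume "p \<in> (H \<inter> L) <#>\<^bsub>G \<times>\<times> N\<^esub> (K \<inter> L)"
    then obtain u v where uv: "u \<in> H \<inter> L" "v \<in> K \<inter> L" "p = u \<otimes>\<^bsub>G \<times>\<times> N\<^esub> v"
      unfolding set_mult_def by blast
    have "subgroup L (G \<times>\<times> N)" using L by (simp add: finite_index_subgroup_def)
    then have "p \<in> L" using uv by (simp add: subgroup.m_closed)
    moreover have "fst u \<otimes>\<^bsub>G\<^esub> fst v \<in> D"
      unfolding D_def set_mult_def using uv(1,2) by blast
    then have "fst p \<in> D" using uv(3) by (simp add: mult_DirProd')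
    ultimately show "p \<in> {p \<in> carrier (G \<times>\<times> N). fst p \<in> D} \<inter> L"
      unfolding L_def by simp
  qed
  finally have "separable_in (G \<times>\<times> N) ((H \<inter> L) <#>\<^bsub>G \<times>\<times> N\<^esub> (K \<inter> L))" .
  moreover have "subgroup H (G \<times>\<times> N)" "subgroup K (G \<times>\<times> N)"
    using H K by (simp_all add: finitely_generated_subgroup_def)
  ultimately show ?thesis by (rule P.separable_in_double_coset_finite_index[OF _ _ L, rotated 2])
qed

section \<open>Induction over the normal subgroups of the nilpotent factor\<close>

theorem theorem1p4:
  fixes G :: "('a, 'b) monoid_scheme" and N :: "('c, 'd) monoid_scheme"
  assumes "group G" and "double_coset_separable G"
    and "group N" and "finitely_generated_group N" and "nilpotent_group N"
  shows "double_coset_separable (G \<times>\<times> N)"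
proof -
  let ?P = "G \<times>\<times> N"
  interpret G: group G by (rule assms(1))
  interpret N: group N by (rule assms(3))
  interpret P: group ?P by (rule DirProd_group[OF assms(1,3)])
  \<comment> \<open>Only \<open>H\<close> is required to contain the copy of \<open>Z\<close>;
    \<open>K\<close> stays arbitrary, so enlarging \<open>H\<close> alone carries the
    induction.\<close>
  define good where "good Z \<longleftrightarrow> (\<forall>H K. finitely_generated_subgroup ?P H \<longrightarrow>
    finitely_generated_subgroup ?P K \<longrightarrow> {\<one>\<^bsub>G\<^esub>} \<times> Z \<subseteq> H \<longrightarrow> separable_in ?P (H <#>\<^bsub>?P\<^esub> K))" for Z
  \<comment> \<open>The induction is run on a maximal counterexample, which exists because all
    subgroups of \<open>N\<close> are finitely generated.\<close>
  define \<A> where "\<A> = {Z. Z \<lhd> N \<and> \<not> good Z}"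
  have "\<A> = {}"
  proof (rule ccontr)
    assume ne: "\<A> \<noteq> {}"
    have "subgroup Z N" if "Z \<in> \<A>" for Z using that by (auto simp: \<A>_def normal_imp_subgroup)
    then obtain Z where Z: "Z \<in> \<A>" and max: "\<And>U. \<lbrakk>U \<in> \<A>; Z \<subseteq> U\<rbrakk> \<Longrightarrow> U = Z"
      using N.maximal_subgroup_in_family[OF N.nilpotent_finitely_generated_subgroups[OF assms(4,5)] ne]
      by blast
    interpret Z: normal Z N using Z by (simp add: \<A>_def)
    have "\<not> finite_index_subgroup N Z"
      using Z double_coset_separable_DirProd_finite_index[OF assms(2,3)] by (auto simp: \<A>_def good_def)
    then have "infinite (rcosets\<^bsub>N\<^esub> Z)" using Z.subgroup_axioms by (simp add: finite_index_subgroup_def)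
    then obtain z where z: "z \<in> center_mod N Z" "\<And>k::nat. k > 0 \<Longrightarrow> z [^]\<^bsub>N\<^esub> k \<notin> Z"
      using N.nilpotent_center_mod_power_notin[OF assms(4,5) Z.normal_axioms] by blast
    have zN: "z \<in> carrier N" using z by (simp add: center_mod_def)
    define z' where "z' = (\<one>\<^bsub>G\<^esub>, z)"
    interpret Z': normal "{\<one>\<^bsub>G\<^esub>} \<times> Z" ?P
      by (rule G.DirProd_normal[OF assms(3) G.one_is_normal Z.normal_axioms])
    \<comment> \<open>\<open>z'\<close> commutes with the factor \<open>G\<close>, so its centrality
      is a question about \<open>N\<close> alone.\<close>
    have z': "z' \<in> center_mod ?P ({\<one>\<^bsub>G\<^esub>} \<times> Z)"
      using z(1) assms(1,3) by (auto simp: z'_def center_mod_def centralizer_mod_def)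
    have z'_pow: "z' [^]\<^bsub>?P\<^esub> j = (\<one>\<^bsub>G\<^esub>, z [^]\<^bsub>N\<^esub> j)" for j :: nat
      by (induction j) (auto simp: z'_def)
    have "separable_in ?P (H <#>\<^bsub>?P\<^esub> K)"
      if H: "finitely_generated_subgroup ?P H" and K: "finitely_generated_subgroup ?P K"
        and ZH: "{\<one>\<^bsub>G\<^esub>} \<times> Z \<subseteq> H" for H K
      unfolding P.separable_in_iff
    proof (intro conjI ballI)
      have sub: "subgroup H ?P" "subgroup K ?P"
        using H K by (auto simp: finitely_generated_subgroup_def)
      then show "H <#>\<^bsub>?P\<^esub> K \<subseteq> carrier ?P"
        by (intro P.set_mult_closed subgroup.subset)
      fix x assume x: "x \<in> carrier ?P - (H <#>\<^bsub>?P\<^esub> K)"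
      then have "x \<notin> H <#>\<^bsub>?P\<^esub> K" by simp
      then obtain j :: nat where j: "j > 0"
        "x \<notin> generate ?P (insert (z' [^]\<^bsub>?P\<^esub> j) H) <#>\<^bsub>?P\<^esub> K"
        by (rule Z'.double_coset_avoiding_power[OF sub(1) ZH sub(2) z'])
      define H' where "H' = generate ?P (insert (z' [^]\<^bsub>?P\<^esub> j) H)"
      define U where "U = generate N (insert (z [^]\<^bsub>N\<^esub> j) Z)"
      have zj: "z [^]\<^bsub>N\<^esub> j \<in> center_mod N Z"
        using N.subgroup_int_pow_closed[OF Z.subgroup_center_mod z(1), of "int j"]
        by (simp add: int_pow_int)
      have ZU: "Z \<subseteq> U" "z [^]\<^bsub>N\<^esub> j \<in> U" unfolding U_def by (auto intro: generate.incl)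
      have "subgroup U N"
        unfolding U_def using zN Z.subset by (intro N.generate_is_subgroup) auto
      moreover have "U \<subseteq> center_mod N Z"
        unfolding U_def using zj Z.subset_center_mod
        by (intro N.generate_subgroup_incl Z.subgroup_center_mod) auto
      ultimately have U: "U \<lhd> N" using ZU(1) by (intro Z.normal_between_center_mod)
      \<comment> \<open>\<open>U\<close> is strictly larger than \<open>Z\<close>, since no positive
        power of \<open>z\<close> lies in \<open>Z\<close>.\<close>
      have "U \<notin> \<A>" using max[OF _ ZU(1)] ZU(2) z(2)[OF j(1)] by blast
      then have good: "good U" using U by (simp add: \<A>_def)
      have z'P: "z' [^]\<^bsub>?P\<^esub> j \<in> carrier ?P" using zN by (simp add: z'_pow)
      have H': "finitely_generated_subgroup ?P H'"
        unfolding H'_def using H z'P by (rule P.finitely_generated_subgroup_insert)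
      then have H'_sub: "subgroup H' ?P" by (simp add: finitely_generated_subgroup_def)
      have HH': "H \<subseteq> H'" unfolding H'_def by (auto intro: generate.incl)
      have "{\<one>\<^bsub>G\<^esub>} \<times> U \<subseteq> H'"
      proof -
        interpret i: group_hom N ?P "\<lambda>n. (\<one>\<^bsub>G\<^esub>, n)"
          by (intro group_hom.intro group_hom_axioms.intro P.is_group N.is_group) (auto simp: hom_def)
        have "Pair \<one>\<^bsub>G\<^esub> ` insert (z [^]\<^bsub>N\<^esub> j) Z \<subseteq> H'"
          using ZH HH' by (auto simp: H'_def z'_pow intro: generate.incl)
        then have "generate ?P (Pair \<one>\<^bsub>G\<^esub> ` insert (z [^]\<^bsub>N\<^esub> j) Z) \<subseteq> H'"
          using H'_sub by (rule P.generate_subgroup_incl)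
        moreover have "generate ?P (Pair \<one>\<^bsub>G\<^esub> ` insert (z [^]\<^bsub>N\<^esub> j) Z) = Pair \<one>\<^bsub>G\<^esub> ` U"
          unfolding U_def using zN Z.subset by (intro i.generate_img) auto
        ultimately show ?thesis by auto
      qed
      then have "separable_in ?P (H' <#>\<^bsub>?P\<^esub> K)" using good H' K by (simp add: good_def)
      \<comment> \<open>A neighbourhood of \<open>x\<close> that misses H'K also misses the smaller
        set HK.\<close>
      then obtain M where M: "finite_index_subgroup ?P M" "(M #>\<^bsub>?P\<^esub> x) \<inter> (H' <#>\<^bsub>?P\<^esub> K) = {}"
        using P.separable_in_avoiding_coset[of "H' <#>\<^bsub>?P\<^esub> K" x] x j(2) unfolding H'_def by blast
      moreover have "H <#>\<^bsub>?P\<^esub> K \<subseteq> H' <#>\<^bsub>?P\<^esub> K" using HH' by (intro mono_set_mult) auto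
      ultimately show "\<exists>M. finite_index_subgroup ?P M \<and> (M #>\<^bsub>?P\<^esub> x) \<inter> (H <#>\<^bsub>?P\<^esub> K) = {}"
        by blast
    qed
    then have "good Z" by (simp add: good_def)
    then show False using Z by (simp add: \<A>_def)
  qed
  \<comment> \<open>For the trivial subgroup the containment required of \<open>H\<close> always
    holds.\<close>
  then have "good {\<one>\<^bsub>N\<^esub>}" using N.one_is_normal by (auto simp: \<A>_def)
  moreover have "{\<one>\<^bsub>G\<^esub>} \<times> {\<one>\<^bsub>N\<^esub>} \<subseteq> H" if "finitely_generated_subgroup ?P H" for H
    using that subgroup.one_closed[of H ?P] by (auto simp: finitely_generated_subgroup_def)
  ultimately show ?thesis
    using P.is_group by (auto simp: double_coset_separable_def good_def)
qed

end
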